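(* For every positive integer $k$, $11\log(k)$ is a $k$-feasible constant; that is, every $k$-multiple tree $G$ has a spanning tree factorization $(T_1,\ldots,T_k)$ such that $|d_{T_i}(v)-\frac{d_G(v)}{k}|\leq 11\log(k)$ for all $v\in V(G)$ and $i\in\{1,\ldots,k\}$.
   Context: Graphs are finite and may have parallel edges. For a positive integer $k$, a graph $G$ is a $k$-multiple tree if there are spanning trees $T_1,\ldots,T_k$ of $G$ that are pairwise edge-disjoint and satisfy $E(T_1)\cup\cdots\cup E(T_k)=E(G)$; the tuple $(T_1,\ldots,T_k)$ is then called a spanning tree factorization of $G$. $d_H(v)$ denotes the number of edges of $H$ incident to $v$. A real constant $c_k$ is $k$-feasible if every $k$-multiple tree $G$ has a spanning tree factorization $(T_1,\ldots,T_k)$ with $|d_{T_i}(v)-\frac{d_G(v)}{k}|\leq c_k$ for all $v\in V(G)$, $i\in\{1,\ldots,k\}$. $\log$ is the logarithm to base $2$. *)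

theory Defs
  imports Complex_Main
begin

record ('v, 'e) multigraph =
  vertices :: "'v set"
  edges :: "'e set"
  ends :: "'e \<Rightarrow> 'v set"

text \<open>Parallel edges are distinct elements of \<open>edges\<close> with the same set of ends. Loops are excluded
  by the condition on \<open>card\<close>. Only the values of \<open>ends\<close> on \<open>edges\<close> are meaningful.\<close>

definition wf_multigraph :: "('v, 'e) multigraph \<Rightarrow> bool" where
  "wf_multigraph G \<longleftrightarrow> finite (vertices G) \<and> finite (edges G) \<and>
     (\<forall>e\<in>edges G. ends G e \<subseteq> vertices G \<and> card (ends G e) = 2)"

definition subgraph :: "('v, 'e) multigraph \<Rightarrow> ('v, 'e) multigraph \<Rightarrow> bool" where
  "subgraph H G \<longleftrightarrow> wf_multigraph H \<and> wf_multigraph G \<and>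
     vertices H \<subseteq> vertices G \<and> edges H \<subseteq> edges G \<and> (\<forall>e\<in>edges H. ends H e = ends G e)"

definition deg :: "('v, 'e) multigraph \<Rightarrow> 'v \<Rightarrow> nat" where
  "deg H v = card {e \<in> edges H. v \<in> ends H e}"

definition adjacent :: "('v, 'e) multigraph \<Rightarrow> 'v \<Rightarrow> 'v \<Rightarrow> bool" where
  "adjacent G u v \<longleftrightarrow> (\<exists>e\<in>edges G. ends G e = {u, v})"

definition connected_graph :: "('v, 'e) multigraph \<Rightarrow> bool" where
  "connected_graph G \<longleftrightarrow> vertices G \<noteq> {} \<and>
     (\<forall>u\<in>vertices G. \<forall>v\<in>vertices G. (adjacent G)\<^sup>*\<^sup>* u v)"

text \<open>The edge \<open>es ! i\<close> joins \<open>vs ! i\<close> to its cyclic successor in \<open>vs\<close>; two parallel edges form a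
  cycle of length 2.\<close>

definition is_cycle :: "('v, 'e) multigraph \<Rightarrow> 'v list \<Rightarrow> 'e list \<Rightarrow> bool" where
  "is_cycle G vs es \<longleftrightarrow> length vs = length es \<and> 2 \<le> length es \<and>
     distinct vs \<and> distinct es \<and> set vs \<subseteq> vertices G \<and> set es \<subseteq> edges G \<and>
     (\<forall>i<length es. ends G (es ! i) = {vs ! i, vs ! (Suc i mod length vs)})"

definition is_tree :: "('v, 'e) multigraph \<Rightarrow> bool" where
  "is_tree G \<longleftrightarrow> wf_multigraph G \<and> connected_graph G \<and> \<not> (\<exists>vs es. is_cycle G vs es)"

definition spanning_tree :: "('v, 'e) multigraph \<Rightarrow> ('v, 'e) multigraph \<Rightarrow> bool" where
  "spanning_tree T G \<longleftrightarrow> subgraph T G \<and> vertices T = vertices G \<and> is_tree T"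

text \<open>A \<open>k\<close>-tuple of graphs is a function on \<open>nat\<close>, of which only the values on \<open>{1..k}\<close> are used.\<close>

definition spanning_tree_factorization ::
    "nat \<Rightarrow> (nat \<Rightarrow> ('v, 'e) multigraph) \<Rightarrow> ('v, 'e) multigraph \<Rightarrow> bool" where
  "spanning_tree_factorization k T G \<longleftrightarrow>
     (\<forall>i\<in>{1..k}. spanning_tree (T i) G) \<and>
     (\<forall>i\<in>{1..k}. \<forall>j\<in>{1..k}. i \<noteq> j \<longrightarrow> edges (T i) \<inter> edges (T j) = {}) \<and>
     (\<Union>i\<in>{1..k}. edges (T i)) = edges G"

definition multiple_tree :: "nat \<Rightarrow> ('v, 'e) multigraph \<Rightarrow> bool" where
  "multiple_tree k G \<longleftrightarrow> wf_multigraph G \<and> (\<exists>T. spanning_tree_factorization k T G)"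

text \<open>The type argument names the types of vertices and edges over which the graphs range, since a
  definition cannot quantify over types; a theorem with free type variables covers all of them.\<close>

definition feasible :: "('v, 'e) multigraph itself \<Rightarrow> nat \<Rightarrow> real \<Rightarrow> bool" where
  "feasible _ k c \<longleftrightarrow>
     (\<forall>G :: ('v, 'e) multigraph. multiple_tree k G \<longrightarrow>
       (\<exists>T. spanning_tree_factorization k T G \<and>
         (\<forall>v\<in>vertices G. \<forall>i\<in>{1..k}.
           \<bar>real (deg (T i) v) - real (deg G v) / real k\<bar> \<le> c)))"

end

theory Submission
  imports Defs
begin

text \<open>Two edge-disjoint spanning trees can be re-partitioned so that their degrees differ by at most 6
  at every vertex. Their union has average degree below 4, so it has a vertex \<open>v\<close> of degree 2 or 3.
  If \<open>v\<close> has degree 3, replace two of its edges \<open>vx\<close>, \<open>vy\<close> by the edge \<open>xy\<close> and drop the third edge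
  \<open>vz\<close>; its colour is then forced to be opposite to that of \<open>xy\<close> and shifts the imbalance of \<open>z\<close> by
  one. At least two of the three edges can play the role of \<open>vz\<close>, and a discharging argument provides
  a \<open>v\<close> for which some admissible \<open>z\<close> has degree at most 7; so every vertex suffers only boundedly many
  shifts. If \<open>v\<close> has degree 2, its two edges get opposite colours in either order, and these free
  choices are balanced like the orientation of a graph with in- and out-degrees differing by at most 1.

  For \<open>k = 2 ^ t\<close> trees, averaging pairs along a hypercube gives the error \<open>3 t\<close>. For other \<open>k\<close>, alternate
  between pairing the surplus trees with trees of a block of \<open>2 ^ t > k / 2\<close> trees and averaging
  that block: this halves the spread of the degrees, up to an error of order \<open>t\<close>.\<close>

section \<open>Connectivity by cuts\<close>

text \<open>With cuts instead of paths, eliminating or restoring a vertex only requires deciding on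
  which side of a cut it goes. The end map \<open>en\<close> is a separate argument so that an edge
  can be given new ends by a function update.\<close>

definition cut_connected :: "'v set \<Rightarrow> ('e \<Rightarrow> 'v set) \<Rightarrow> 'e set \<Rightarrow> bool" where
  "cut_connected V en F \<longleftrightarrow>
     (\<forall>X. X \<subseteq> V \<longrightarrow> X \<noteq> {} \<longrightarrow> X \<noteq> V \<longrightarrow>
       (\<exists>e\<in>F. en e \<inter> X \<noteq> {} \<and> en e \<inter> (V - X) \<noteq> {}))"

lemma cut_connectedD:
  assumes "cut_connected V en F" "X \<subseteq> V" "X \<noteq> {}" "X \<noteq> V"
  obtains e where "e \<in> F" "en e \<inter> X \<noteq> {}" "en e \<inter> (V - X) \<noteq> {}"
  using assms unfolding cut_connected_def by blast

lemma cut_connectedI: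
  assumes "\<And>X. X \<subseteq> V \<Longrightarrow> X \<noteq> {} \<Longrightarrow> X \<noteq> V \<Longrightarrow> \<exists>e\<in>F. en e \<inter> X \<noteq> {} \<and> en e \<inter> (V - X) \<noteq> {}"
  shows "cut_connected V en F"
  using assms unfolding cut_connected_def by blast

lemma cut_connected_cong:
  assumes "\<And>e. e \<in> F \<Longrightarrow> en e = en' e"
  shows "cut_connected V en F = cut_connected V en' F"
  using assms unfolding cut_connected_def by simp

lemma cut_connected_add_leaf:
  assumes "cut_connected V en F" "y \<notin> V" "x \<in> V" "en e = {y, x}"
  shows "cut_connected (insert y V) en (insert e F)"
proof (rule cut_connectedI)
  fix X assume X: "X \<subseteq> insert y V" "X \<noteq> {}" "X \<noteq> insert y V"
  show "\<exists>e\<in>insert e F. en e \<inter> X \<noteq> {} \<and> en e \<inter> (insert y V - X) \<noteq> {}"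
  \<comment> \<open>Only the cuts \<open>{y}\<close> and \<open>V\<close> do not restrict to a cut
    of \<open>V\<close>; the new edge crosses both.\<close>
  proof (cases "X - {y} = {} \<or> X - {y} = V")
    case True
    then have "X = {y} \<or> X = V" using X assms(2) by blast
    then show ?thesis using assms(2,3,4) by auto
  next
    case False
    then obtain g where "g \<in> F" "en g \<inter> (X - {y}) \<noteq> {}" "en g \<inter> (V - (X - {y})) \<noteq> {}"
      using cut_connectedD[OF assms(1), of "X - {y}"] X(1) by blast
    then show ?thesis using assms(2) by blast
  qed
qed

lemma cut_connected_remove_leaf:
  assumes "cut_connected V en F" "v \<in> V" "w \<noteq> v" "en e = {v, w}"
    and only: "\<And>g. g \<in> F \<Longrightarrow> v \<in> en g \<Longrightarrow> g = e"
  shows "cut_connected (V - {v}) en (F - {e})"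
proof (rule cut_connectedI)
  fix X assume X: "X \<subseteq> V - {v}" "X \<noteq> {}" "X \<noteq> V - {v}"
  \<comment> \<open>Placing \<open>v\<close> on the side of \<open>w\<close> keeps \<open>e\<close>
    from crossing, so the crossing edge that is found survives.\<close>
  define Y where "Y = (if w \<in> X then insert v X else X)"
  have "Y \<subseteq> V" "Y \<noteq> {}" "Y \<noteq> V" using X assms(2) by (auto simp: Y_def)
  then obtain g where g: "g \<in> F" "en g \<inter> Y \<noteq> {}" "en g \<inter> (V - Y) \<noteq> {}"
    using cut_connectedD[OF assms(1)] by blast
  have "g \<noteq> e"
    using g assms(3,4) X by (auto simp: Y_def split: if_splits)
  moreover from this have "v \<notin> en g" using only g by blast
  ultimately have "g \<in> F - {e}" "en g \<inter> X \<noteq> {}" "en g \<inter> (V - {v} - X) \<noteq> {}"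
    using g by (auto simp: Y_def split: if_splits)
  then show "\<exists>e\<in>F - {e}. en e \<inter> X \<noteq> {} \<and> en e \<inter> (V - {v} - X) \<noteq> {}" by blast
qed

text \<open>A cut that separates \<open>a\<close> from \<open>b\<close> is crossed by the new edge;
  any other cut extends to \<open>v\<close> in such a way that neither \<open>p\<close> nor
  \<open>q\<close> crosses it.\<close>

lemma cut_connected_smooth:
  assumes "cut_connected V en F" "v \<in> V" "a \<in> V - {v}" "b \<in> V - {v}"
    and "p \<in> F" "q \<in> F" "p \<noteq> q" "en p = {v, a}" "en q = {v, b}"
    and only: "\<And>g. g \<in> F \<Longrightarrow> v \<in> en g \<Longrightarrow> g = p \<or> g = q"
  shows "cut_connected (V - {v}) (en(q := {a, b})) (F - {p})"
proof (rule cut_connectedI)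
  fix X assume X: "X \<subseteq> V - {v}" "X \<noteq> {}" "X \<noteq> V - {v}"
  let ?en = "en(q := {a, b})"
  show "\<exists>e\<in>F - {p}. ?en e \<inter> X \<noteq> {} \<and> ?en e \<inter> (V - {v} - X) \<noteq> {}"
  proof (cases "a \<in> X \<longleftrightarrow> b \<in> X")
    case False
    then show ?thesis using assms(3-7) by (intro bexI[of _ q]) auto
  next
    case True
    define Y where "Y = (if a \<in> X then insert v X else X)"
    have "Y \<subseteq> V" "Y \<noteq> {}" "Y \<noteq> V" using X assms(2) by (auto simp: Y_def)
    then obtain g where g: "g \<in> F" "en g \<inter> Y \<noteq> {}" "en g \<inter> (V - Y) \<noteq> {}"
      using cut_connectedD[OF assms(1)] by blast
    have ne: "g \<noteq> p" "g \<noteq> q"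
      using g assms(3,4,8,9) X True by (auto simp: Y_def split: if_splits)
    then have "v \<notin> en g" using only g by blast
    then show ?thesis
      using g ne by (intro bexI[of _ g]) (auto simp: Y_def split: if_splits)
  qed
qed

text \<open>Deleting \<open>v\<close> leaves two components, one containing \<open>a\<close> and one containing \<open>b\<close>; the new edge
  leads from \<open>c\<close> to the component that does not contain \<open>c\<close>.\<close>

lemma cut_connected_smooth_third:
  assumes "cut_connected V en F" "v \<in> V" "a \<in> V - {v}" "b \<in> V - {v}" "c \<in> V - {v}"
    and "p \<in> F" "q \<in> F" "p \<noteq> q" "en p = {v, a}" "en q = {v, b}"
    and only: "\<And>g. g \<in> F \<Longrightarrow> v \<in> en g \<Longrightarrow> g = p \<or> g = q"
  shows "cut_connected (V - {v}) (en(q := {b, c})) (F - {p}) \<or>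
         cut_connected (V - {v}) (en(p := {a, c})) (F - {q})"
proof (rule ccontr)
  define W where "W = V - {v}"
  define crosses where "crosses g X \<longleftrightarrow> en g \<inter> X \<noteq> {} \<and> en g \<inter> (W - X) \<noteq> {}" for g X
  \<comment> \<open>Covers both redirections: \<open>r\<close> is dropped and \<open>s\<close> now
    joins \<open>y\<close> to \<open>c\<close>. The violated cut has \<open>y\<close> on the side of
    \<open>c\<close>, and \<open>x\<close> on the other side, since otherwise adding
    \<open>v\<close> would give a violated cut of the original graph.\<close>
  have sep: "\<exists>X \<subseteq> W. c \<in> X \<and> y \<in> X \<and> x \<notin> X \<and> (\<forall>g\<in>F - {p, q}. \<not> crosses g X)"
    if not: "\<not> cut_connected W (en(s := {y, c})) (F - {r})"
      and rs: "{r, s} = {p, q}" "r \<noteq> s" "en r = {v, x}" "en s = {v, y}" "x \<in> W" "y \<in> W" for r s x y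
  proof -
    let ?en = "en(s := {y, c})"
    obtain X0 where X0: "X0 \<subseteq> W" "X0 \<noteq> {}" "X0 \<noteq> W"
      "\<forall>g\<in>F - {r}. \<not> (?en g \<inter> X0 \<noteq> {} \<and> ?en g \<inter> (W - X0) \<noteq> {})"
      using not unfolding cut_connected_def by blast
    \<comment> \<open>The complement of a violated cut is violated too, so \<open>c\<close> may be
      taken inside.\<close>
    define X where "X = (if c \<in> X0 then X0 else W - X0)"
    have X: "X \<subseteq> W" "X \<noteq> {}" "X \<noteq> W" "c \<in> X" using X0(1-3) assms(5) by (auto simp: X_def W_def)
    have nc0: "\<not> (?en g \<inter> X \<noteq> {} \<and> ?en g \<inter> (W - X) \<noteq> {})" if "g \<in> F - {r}" for g
    proof -
      have "X = X0 \<or> X = W - X0" by (simp add: X_def)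
      then show ?thesis using X0(4)[rule_format, OF that] X0(1) by blast
    qed
    have sF: "s \<in> F - {r}" using rs assms(6,7) by (metis Diff_iff insertCI insertE singletonD)
    have yX: "y \<in> X" using nc0[OF sF] X(4) rs(6) by auto
    have nc: "\<not> crosses g X" if "g \<in> F - {p, q}" for g
    proof -
      have "g \<in> F - {r}" "g \<noteq> s" using that rs(1) by blast+
      then show ?thesis using nc0[of g] by (auto simp: crosses_def)
    qed
    have "x \<notin> X"
    proof
      assume "x \<in> X"
      have "insert v X \<subseteq> V" "insert v X \<noteq> {}" "insert v X \<noteq> V"
        using X assms(2) by (auto simp: W_def)
      then obtain g where g: "g \<in> F" "en g \<inter> insert v X \<noteq> {}" "en g \<inter> (V - insert v X) \<noteq> {}"
        using cut_connectedD[OF assms(1)] by blast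
      have "g \<noteq> r" "g \<noteq> s" using g(3) \<open>x \<in> X\<close> yX rs(3,4) by auto
      then have g': "g \<in> F - {p, q}" using g(1) rs(1) by blast
      then have "v \<notin> en g" using only by blast
      then show False using nc[OF g'] g by (auto simp: crosses_def W_def)
    qed
    then show ?thesis using X yX nc by blast
  qed
  assume "\<not> ?thesis"
  then have n1: "\<not> cut_connected W (en(q := {b, c})) (F - {p})"
    and n2: "\<not> cut_connected W (en(p := {a, c})) (F - {q})" by (auto simp: W_def)
  obtain X where X: "X \<subseteq> W" "c \<in> X" "b \<in> X" "a \<notin> X" "\<forall>g\<in>F - {p, q}. \<not> crosses g X"
    using sep[OF n1 _ assms(8,9,10)] assms(3,4) by (auto simp: W_def)
  obtain Y where Y: "Y \<subseteq> W" "c \<in> Y" "a \<in> Y" "b \<notin> Y" "\<forall>g\<in>F - {p, q}. \<not> crosses g Y"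
    using sep[OF n2 _ not_sym[OF assms(8)] assms(10,9)] assms(3,4) by (auto simp: W_def)
  \<comment> \<open>The intersection contains \<open>c\<close> but none of \<open>v\<close>,
    \<open>a\<close>, \<open>b\<close>, so \<open>p\<close> and \<open>q\<close> do not touch it,
    and any other edge leaving it would cross \<open>X\<close> or \<open>Y\<close>.\<close>
  have "X \<inter> Y \<subseteq> V" "X \<inter> Y \<noteq> {}" "X \<inter> Y \<noteq> V" using X Y assms(2) by (auto simp: W_def)
  then obtain g where g: "g \<in> F" "en g \<inter> (X \<inter> Y) \<noteq> {}" "en g \<inter> (V - X \<inter> Y) \<noteq> {}"
    using cut_connectedD[OF assms(1)] by blast
  have "v \<notin> X" using X(1) by (auto simp: W_def)
  then have "g \<noteq> p" "g \<noteq> q" using g(2) X Y assms(9,10) by auto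
  then have g': "g \<in> F - {p, q}" "v \<notin> en g" using g(1) only by auto
  then show False using g X(5) Y(5) unfolding crosses_def W_def by blast
qed

text \<open>The reverse of \<open>cut_connected_smooth\<close>: a cut that separates
  \<open>v\<close> from \<open>a\<close> or \<open>b\<close> is crossed by \<open>p\<close> or
  \<open>q\<close>. Any other cut keeps \<open>a\<close> and \<open>b\<close> together, so the edge
  crossing its restriction to \<open>V\<close> is not \<open>q\<close>.\<close>

lemma cut_connected_subdivide:
  assumes "cut_connected V (en(q := {a, b})) F" "q \<in> F" "p \<noteq> q" "en p = {v, a}" "en q = {v, b}"
    "v \<notin> V" "a \<in> V" "b \<in> V"
  shows "cut_connected (insert v V) en (insert p F)"
proof (rule cut_connectedI)
  fix X assume X: "X \<subseteq> insert v V" "X \<noteq> {}" "X \<noteq> insert v V"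
  show "\<exists>e\<in>insert p F. en e \<inter> X \<noteq> {} \<and> en e \<inter> (insert v V - X) \<noteq> {}"
  proof (cases "(v \<in> X \<and> \<not> {a, b} \<subseteq> X) \<or> (v \<notin> X \<and> {a, b} \<inter> X \<noteq> {})")
    case True
    show ?thesis
    proof (cases "a \<in> X \<longleftrightarrow> v \<in> X")
      case False
      then show ?thesis using assms by (intro bexI[of _ p]) auto
    next
      case True
      with \<open>(v \<in> X \<and> \<not> {a, b} \<subseteq> X) \<or> (v \<notin> X \<and> {a, b} \<inter> X \<noteq> {})\<close>
      show ?thesis using assms by (intro bexI[of _ q]) auto
    qed
  next
    case False
    have "X - {v} \<subseteq> V" "X - {v} \<noteq> {}" "X - {v} \<noteq> V" using False X assms(6,7) by blast+
    then obtain g where g: "g \<in> F" "(en(q := {a, b})) g \<inter> (X - {v}) \<noteq> {}"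
      "(en(q := {a, b})) g \<inter> (V - (X - {v})) \<noteq> {}"
      using cut_connectedD[OF assms(1)] by metis
    have "g \<noteq> q" using g False assms(6-8) by (auto split: if_splits)
    then show ?thesis using g assms(6) by (intro bexI[of _ g]) auto
  qed
qed

text \<open>A tree is grown from one vertex: as long as \<open>X\<close> is proper, some edge of
  \<open>F\<close> leaves it and attaches a new leaf, so \<open>m\<close> edges connect
  \<open>m + 1\<close> vertices.\<close>

lemma cut_connected_spanning_subset:
  assumes "cut_connected V en F" "finite V" "V \<noteq> {}" "\<And>e. e \<in> F \<Longrightarrow> en e \<subseteq> V \<and> card (en e) \<le> 2"
  obtains F' where "F' \<subseteq> F" "finite F'" "card F' + 1 = card V" "cut_connected V en F'"
proof -
  have "\<exists>X F'. X \<subseteq> V \<and> card X = Suc m \<and> F' \<subseteq> F \<and> finite F' \<and> card F' = m \<and>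
          (\<forall>e\<in>F'. en e \<subseteq> X) \<and> cut_connected X en F'" if "m < card V" for m
    using that
  proof (induction m)
    case 0
    obtain x where "x \<in> V" using assms(3) by blast
    moreover have "cut_connected {x} en {}" unfolding cut_connected_def by blast
    ultimately show ?case by (intro exI[of _ "{x}"] exI[of _ "{}"]) auto
  next
    case (Suc m)
    then obtain X F' where X: "X \<subseteq> V" "card X = Suc m" "F' \<subseteq> F" "finite F'" "card F' = m"
      "\<forall>e\<in>F'. en e \<subseteq> X" "cut_connected X en F'" by auto
    have "X \<noteq> {}" "X \<noteq> V" "finite X" using X Suc.prems assms(2) finite_subset by auto
    then obtain e where e: "e \<in> F" "en e \<inter> X \<noteq> {}" "en e \<inter> (V - X) \<noteq> {}"
      using cut_connectedD[OF assms(1)] X(1) by metis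
    then obtain x y where xy: "x \<in> en e" "x \<in> X" "y \<in> en e" "y \<in> V" "y \<notin> X" by blast
    have fin: "finite (en e)" using assms(2,4) e(1) finite_subset by blast
    have "card {y, x} = 2" using xy by (intro card_2_iff[THEN iffD2]) auto
    then have ee: "en e = {y, x}"
      using card_subset_eq[OF fin, of "{y, x}"] card_mono[OF fin, of "{y, x}"] xy assms(4)[OF e(1)]
      by auto
    have "e \<notin> F'" using X(6) xy by blast
    moreover have "cut_connected (insert y X) en (insert e F')"
      using cut_connected_add_leaf[OF X(7) xy(5,2) ee] .
    ultimately show ?case
      using X xy ee e(1) \<open>finite X\<close>
      by (intro exI[of _ "insert y X"] exI[of _ "insert e F'"]) auto
  qed
  moreover have "card V > 0" using assms(2,3) by (simp add: card_gt_0_iff)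
  ultimately obtain X F' where X: "X \<subseteq> V" "card X = Suc (card V - 1)" "F' \<subseteq> F" "finite F'"
    "card F' = card V - 1" "cut_connected X en F'"
    by (metis diff_less zero_less_one)
  have "X = V" using X(1,2) \<open>card V > 0\<close> assms(2) by (intro card_subset_eq) auto
  then show ?thesis using that[of F'] X \<open>card V > 0\<close> by simp
qed

text \<open>Refutes connectedness of edge sets that are too small, when a cycle edge is removed or a
  new edge has equal ends.\<close>

lemma cut_connected_card_le:
  assumes "cut_connected V en F" "finite V" "V \<noteq> {}" "finite F"
    "\<And>e. e \<in> F \<Longrightarrow> en e \<subseteq> V \<and> card (en e) \<le> 2"
  shows "card V \<le> card F + 1"
  using cut_connected_spanning_subset[OF assms(1-3,5)] assms(4)
  by (metis add_le_mono1 card_mono)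

section \<open>Spanning trees as edge sets\<close>

text \<open>The edge count replaces acyclicity because it is easy to follow through local changes;
  \<open>is_tree_imp_sp_tree\<close> and \<open>sp_tree_imp_is_tree\<close> connect it with
  \<open>is_tree\<close>.\<close>

definition sp_tree :: "'v set \<Rightarrow> ('e \<Rightarrow> 'v set) \<Rightarrow> 'e set \<Rightarrow> bool" where
  "sp_tree V en F \<longleftrightarrow> finite V \<and> V \<noteq> {} \<and> finite F \<and> (\<forall>e\<in>F. en e \<subseteq> V \<and> card (en e) = 2) \<and>
     cut_connected V en F \<and> card F + 1 = card V"

lemma sp_tree_fun_upd: "q \<notin> F \<Longrightarrow> sp_tree V (en(q := X)) F = sp_tree V en F"
  using cut_connected_cong[of F "en(q := X)" en V] unfolding sp_tree_def
  by (metis fun_upd_other)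

text \<open>No edge crosses the set of vertices reachable from \<open>u\<close>; conversely, a walk
  cannot leave a set that no edge crosses.\<close>

lemma cut_connected_iff_connected_graph:
  assumes "wf_multigraph T" "vertices T \<noteq> {}"
  shows "cut_connected (vertices T) (ends T) (edges T) \<longleftrightarrow> connected_graph T"
proof
  assume cut: "cut_connected (vertices T) (ends T) (edges T)"
  have "(adjacent T)\<^sup>*\<^sup>* u v" if u: "u \<in> vertices T" and v: "v \<in> vertices T" for u v
  proof (rule ccontr)
    assume "\<not> (adjacent T)\<^sup>*\<^sup>* u v"
    define X where "X = {w \<in> vertices T. (adjacent T)\<^sup>*\<^sup>* u w}"
    have "X \<subseteq> vertices T" "X \<noteq> {}" "X \<noteq> vertices T"
      using u v \<open>\<not> (adjacent T)\<^sup>*\<^sup>* u v\<close> by (auto simp: X_def)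
    then obtain e where e: "e \<in> edges T" "ends T e \<inter> X \<noteq> {}" "ends T e \<inter> (vertices T - X) \<noteq> {}"
      using cut_connectedD[OF cut] by metis
    then obtain x y where xy: "x \<in> ends T e" "x \<in> X" "y \<in> ends T e" "y \<in> vertices T" "y \<notin> X" by blast
    have "card (ends T e) = 2" using assms(1) e(1) by (simp add: wf_multigraph_def)
    then have "ends T e = {x, y}" using xy by (auto simp: card_2_iff)
    then have "adjacent T x y" using e(1) by (auto simp: adjacent_def)
    then have "y \<in> X" using xy by (auto simp: X_def intro: rtranclp.rtrancl_into_rtrancl)
    then show False using xy by simp
  qed
  then show "connected_graph T" using assms(2) by (simp add: connected_graph_def)
next
  assume conn: "connected_graph T"
  show "cut_connected (vertices T) (ends T) (edges T)"
  proof (rule cut_connectedI, rule ccontr)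
    fix X assume X: "X \<subseteq> vertices T" "X \<noteq> {}" "X \<noteq> vertices T"
      and not: "\<not> (\<exists>e\<in>edges T. ends T e \<inter> X \<noteq> {} \<and> ends T e \<inter> (vertices T - X) \<noteq> {})"
    obtain u v where uv: "u \<in> X" "v \<in> vertices T - X" using X by blast
    then have "(adjacent T)\<^sup>*\<^sup>* u v" using conn X by (auto simp: connected_graph_def)
    then have "v \<in> X"
    proof induction
      case base
      then show ?case by (rule uv)
    next
      case (step y z)
      then obtain e where e: "e \<in> edges T" "ends T e = {y, z}" by (auto simp: adjacent_def)
      then have "z \<in> vertices T" using assms(1) by (auto simp: wf_multigraph_def)
      then show ?case using not e step.IH by auto
    qed
    then show False using uv by simp
  qed
qed

section \<open>Acyclicity and the edge count\<close>

inductive simple_path :: "('e \<Rightarrow> 'v set) \<Rightarrow> 'e set \<Rightarrow> 'v \<Rightarrow> 'v list \<Rightarrow> 'e list \<Rightarrow> bool"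
  for en F u where
  start: "simple_path en F u [u] []"
| extend: "simple_path en F u vs es \<Longrightarrow> e \<in> F \<Longrightarrow> en e = {last vs, y} \<Longrightarrow> y \<notin> set vs \<Longrightarrow>
    simple_path en F u (vs @ [y]) (es @ [e])"

lemma simple_path_properties:
  assumes "simple_path en F u vs es"
  shows "length vs = Suc (length es) \<and> distinct vs \<and> distinct es \<and> set es \<subseteq> F \<and> vs ! 0 = u \<and>
    (\<forall>e\<in>set es. en e \<subseteq> set vs) \<and> (\<forall>i<length es. en (es ! i) = {vs ! i, vs ! Suc i})"
  using assms
proof induction
  case start
  then show ?case by simp
next
  case (extend vs es e y)
  have "e \<notin> set es" using extend by auto
  moreover have "en e \<subseteq> insert y (set vs)" using extend by (cases vs rule: rev_cases) auto
  moreover have "last vs = vs ! length es" using extend by (metis diff_Suc_1 last_conv_nth length_0_conv nat.distinct(1))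
  ultimately show ?case using extend by (auto simp: nth_append less_Suc_eq)
qed

lemma simple_path_to:
  assumes "simple_path en F u vs es" "w \<in> set vs"
  shows "\<exists>vs es. simple_path en F u vs es \<and> last vs = w"
  using assms
proof induction
  case start
  then show ?case using simple_path.start[of en F u] by force
next
  case (extend vs es e y)
  show ?case
  proof (cases "w = y")
    case True
    then show ?thesis using simple_path.extend[OF extend.hyps] by fastforce
  qed (use extend in auto)
qed

text \<open>No edge leaves the set of vertices at which a simple path ends: an edge to a vertex
  outside extends the path, and that vertex is not yet on the path because otherwise a prefix would
  end there.\<close>

lemma cut_connected_simple_path:
  assumes "cut_connected V en F" "\<And>e. e \<in> F \<Longrightarrow> en e \<subseteq> V \<and> card (en e) = 2" "u \<in> V" "w \<in> V"
  obtains vs es where "simple_path en F u vs es" "last vs = w"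
proof -
  define X where "X = {w \<in> V. \<exists>vs es. simple_path en F u vs es \<and> last vs = w}"
  have "X = V"
  proof (rule ccontr)
    assume "X \<noteq> V"
    moreover have "X \<subseteq> V" by (auto simp: X_def)
    moreover have "u \<in> X" using assms(3) simple_path.start[of en F u] by (force simp: X_def)
    ultimately obtain e where e: "e \<in> F" "en e \<inter> X \<noteq> {}" "en e \<inter> (V - X) \<noteq> {}"
      using cut_connectedD[OF assms(1), of X] by blast
    then obtain x y where xy: "x \<in> en e" "x \<in> X" "y \<in> en e" "y \<in> V" "y \<notin> X" by blast
    then obtain vs es where p: "simple_path en F u vs es" "last vs = x" by (auto simp: X_def)
    have ee: "en e = {last vs, y}" using assms(2)[OF e(1)] xy p by (auto simp: card_2_iff)
    have "y \<notin> set vs" using simple_path_to[OF p(1)] xy by (auto simp: X_def)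
    then have "simple_path en F u (vs @ [y]) (es @ [e])" using simple_path.extend[OF p(1) e(1) ee] by simp
    then have "y \<in> X" using xy(4) by (force simp: X_def)
    then show False using xy by simp
  qed
  then show ?thesis using assms(4) that by (auto simp: X_def)
qed

text \<open>A connected spanning subset with one edge less than there are vertices must be
  everything: a further edge would close a cycle with the path that joins its ends inside the
  subset.\<close>

lemma is_tree_imp_sp_tree:
  assumes "is_tree T"
  shows "sp_tree (vertices T) (ends T) (edges T)"
proof -
  have wf: "wf_multigraph T" and conn: "connected_graph T" and acyc: "\<And>vs es. \<not> is_cycle T vs es"
    using assms by (auto simp: is_tree_def)
  have ne: "vertices T \<noteq> {}" using conn by (simp add: connected_graph_def)
  have fin: "finite (vertices T)" "finite (edges T)"
    and ends: "\<And>e. e \<in> edges T \<Longrightarrow> ends T e \<subseteq> vertices T \<and> card (ends T e) = 2"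
    using wf by (auto simp: wf_multigraph_def)
  have cut: "cut_connected (vertices T) (ends T) (edges T)"
    using cut_connected_iff_connected_graph[OF wf ne] conn by simp
  obtain F' where F': "F' \<subseteq> edges T" "card F' + 1 = card (vertices T)"
    "cut_connected (vertices T) (ends T) F'"
    using cut_connected_spanning_subset[OF cut fin(1) ne] ends by (metis order_refl)
  have "F' = edges T"
  proof (rule ccontr)
    assume "F' \<noteq> edges T"
    then obtain e where e: "e \<in> edges T" "e \<notin> F'" using F'(1) by blast
    then obtain x y where xy: "ends T e = {x, y}" "x \<noteq> y" "x \<in> vertices T" "y \<in> vertices T"
      using ends[OF e(1)] by (auto simp: card_2_iff)
    obtain vs es where p: "simple_path (ends T) F' x vs es" "last vs = y"
      using cut_connected_simple_path[OF F'(3) _ xy(3,4)] F'(1) ends by (metis subsetD)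
    note pp = simple_path_properties[OF p(1)]
    have "es \<noteq> []" using pp p(2) xy(2) by (cases vs) auto
    have "set vs \<subseteq> vertices T"
      using p(1)
    proof induction
      case (extend vs es e y)
      then have "ends T e \<subseteq> vertices T" using F'(1) ends by blast
      then show ?case using extend by simp
    qed (use xy in simp)
    moreover have "vs ! length es = y" using pp p(2) by (metis diff_Suc_1 last_conv_nth length_0_conv nat.distinct(1))
    moreover have "ends T ((es @ [e]) ! i) = {vs ! i, vs ! (Suc i mod length vs)}"
      if "i < length (es @ [e])" for i
    proof (cases "i < length es")
      case True
      then show ?thesis using pp by (simp add: nth_append)
    next
      case False
      then have "i = length es" using that by simp
      then show ?thesis using pp xy(1) \<open>vs ! length es = y\<close> by (simp add: insert_commute)
    qed
    ultimately have "is_cycle T vs (es @ [e])"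
      using pp e F'(1) p(1) \<open>es \<noteq> []\<close> unfolding is_cycle_def by (auto simp: Suc_le_eq)
    then show False using acyc by blast
  qed
  then show ?thesis using F' fin ne ends cut by (auto simp: sp_tree_def)
qed

text \<open>If \<open>es ! 0\<close> were the only edge crossing a cut, the rest of the cycle from
  \<open>vs ! 1\<close> to \<open>vs ! 0\<close> would stay on one side, and \<open>es ! 0\<close>
  would not cross either.\<close>

lemma cut_connected_remove_cycle_edge:
  assumes wf: "wf_multigraph T" and cyc: "is_cycle T vs es"
    and cut: "cut_connected (vertices T) (ends T) (edges T)"
  shows "cut_connected (vertices T) (ends T) (edges T - {es ! 0})"
proof (rule cut_connectedI, rule ccontr)
  fix X assume X: "X \<subseteq> vertices T" "X \<noteq> {}" "X \<noteq> vertices T"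
    and not: "\<not> (\<exists>e\<in>edges T - {es ! 0}. ends T e \<inter> X \<noteq> {} \<and> ends T e \<inter> (vertices T - X) \<noteq> {})"
  define n where "n = length es"
  have c: "length vs = n" "2 \<le> n" "distinct es" "set es \<subseteq> edges T" "set vs \<subseteq> vertices T"
    "\<And>i. i < n \<Longrightarrow> ends T (es ! i) = {vs ! i, vs ! (Suc i mod n)}"
    using cyc by (auto simp: is_cycle_def n_def)
  have stay: "vs ! i \<in> X \<longleftrightarrow> vs ! (Suc i mod n) \<in> X" if "0 < i" "i < n" for i
  proof -
    have "es ! i \<noteq> es ! 0" using nth_eq_iff_index_eq[OF c(3), of i 0] that unfolding n_def by linarith
    then have "es ! i \<in> edges T - {es ! 0}" using c(4) that by (auto simp: n_def)
    moreover have "vs ! i \<in> vertices T" "vs ! (Suc i mod n) \<in> vertices T"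
      using c(1,2,5) that by (auto simp: subset_iff)
    ultimately show ?thesis using not c(6)[of i] that by auto
  qed
  have "vs ! 1 \<in> X \<longleftrightarrow> vs ! i \<in> X" if "1 \<le> i" "i < n" for i
    using that
  proof (induction i rule: dec_induct)
    case (step i)
    then show ?case using stay[of i] by simp
  qed simp
  from this[of "n - 1"] have "vs ! 1 \<in> X \<longleftrightarrow> vs ! 0 \<in> X"
    using stay[of "n - 1"] c(2) by simp
  moreover obtain e where e: "e \<in> edges T" "ends T e \<inter> X \<noteq> {}" "ends T e \<inter> (vertices T - X) \<noteq> {}"
    using cut_connectedD[OF cut X] by metis
  moreover have "e = es ! 0" using not e by blast
  ultimately show False using c(6)[of 0] c(2) by auto
qed

text \<open>Deleting an edge of a cycle would leave a connected graph with fewer than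
  \<open>card V - 1\<close> edges.\<close>

lemma sp_tree_imp_is_tree:
  assumes "sp_tree V en F"
  shows "is_tree \<lparr>vertices = V, edges = F, ends = en\<rparr>" (is "is_tree ?T")
proof -
  have wf: "wf_multigraph ?T" using assms by (auto simp: sp_tree_def wf_multigraph_def)
  have "connected_graph ?T"
    using cut_connected_iff_connected_graph[OF wf] assms by (simp add: sp_tree_def)
  moreover have "\<not> is_cycle ?T vs es" for vs es
  proof
    assume cyc: "is_cycle ?T vs es"
    then have cut: "cut_connected V en (F - {es ! 0})"
      using cut_connected_remove_cycle_edge[OF wf cyc] assms by (simp add: sp_tree_def)
    have "0 < length es" using cyc unfolding is_cycle_def by linarith
    then have "es ! 0 \<in> F" using cyc by (auto simp: is_cycle_def)
    moreover have "card V \<le> card (F - {es ! 0}) + 1"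
      using cut_connected_card_le[OF cut] assms by (auto simp: sp_tree_def)
    ultimately show False
      using assms card_Suc_Diff1[of F "es ! 0"] by (auto simp: sp_tree_def)
  qed
  ultimately show ?thesis using wf by (auto simp: is_tree_def)
qed

section \<open>Degrees\<close>

definition dg :: "('e \<Rightarrow> 'v set) \<Rightarrow> 'e set \<Rightarrow> 'v \<Rightarrow> nat" where
  "dg en F v = card {e \<in> F. v \<in> en e}"

lemma dg_insert:
  assumes "finite F" "e \<notin> F"
  shows "dg en (insert e F) v = dg en F v + of_bool (v \<in> en e)"
proof (cases "v \<in> en e")
  case True
  then have "{g \<in> insert e F. v \<in> en g} = insert e {g \<in> F. v \<in> en g}" by auto
  then show ?thesis using assms True by (simp add: dg_def)
next
  case False
  then have "{g \<in> insert e F. v \<in> en g} = {g \<in> F. v \<in> en g}" by auto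
  then show ?thesis using False by (simp add: dg_def)
qed

lemma dg_union_disjoint:
  assumes "finite A" "finite B" "A \<inter> B = {}"
  shows "dg en (A \<union> B) v = dg en A v + dg en B v"
proof -
  have "{e \<in> A \<union> B. v \<in> en e} = {e \<in> A. v \<in> en e} \<union> {e \<in> B. v \<in> en e}" by auto
  then show ?thesis using assms by (auto simp: dg_def intro!: card_Un_disjoint)
qed

lemma dg_cong: "(\<And>e. e \<in> F \<Longrightarrow> en e = en' e) \<Longrightarrow> dg en F v = dg en' F v"
  unfolding dg_def by (metis (mono_tags, lifting))

lemma dg_mono: "finite F \<Longrightarrow> F' \<subseteq> F \<Longrightarrow> dg en F' v \<le> dg en F v"
  unfolding dg_def by (intro card_mono) auto

lemma sum_dg:
  assumes "finite X" "finite F"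
  shows "(\<Sum>v\<in>X. dg en F v) = (\<Sum>e\<in>F. card (en e \<inter> X))"
proof -
  have "(\<Sum>v\<in>X. dg en F v) = (\<Sum>v\<in>X. \<Sum>e\<in>F. of_bool (v \<in> en e))"
    using assms by (simp add: dg_def Int_def)
  also have "\<dots> = (\<Sum>e\<in>F. \<Sum>v\<in>X. of_bool (v \<in> en e))" by (rule sum.swap)
  also have "\<dots> = (\<Sum>e\<in>F. card (en e \<inter> X))"
    using assms by (simp add: Int_def conj_commute)
  finally show ?thesis .
qed

lemma sp_tree_dg_pos:
  assumes "sp_tree V en F" "2 \<le> card V" "v \<in> V"
  shows "1 \<le> dg en F v"
proof -
  have "cut_connected V en F" "{v} \<noteq> V" using assms(1,2) by (auto simp: sp_tree_def)
  then have "\<exists>e\<in>F. en e \<inter> {v} \<noteq> {} \<and> en e \<inter> (V - {v}) \<noteq> {}"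
    using assms(3) unfolding cut_connected_def by (elim allE[of _ "{v}"]) simp
  then obtain e where e: "e \<in> F" "en e \<inter> {v} \<noteq> {}" by blast
  then have "e \<in> {e \<in> F. v \<in> en e}" by auto
  moreover have "finite {e \<in> F. v \<in> en e}" using assms by (simp add: sp_tree_def)
  ultimately show ?thesis unfolding dg_def by (metis One_nat_def Suc_leI card_gt_0_iff empty_iff)
qed

lemma sp_tree_dg_outside:
  assumes "sp_tree V en F" "v \<notin> V"
  shows "dg en F v = 0"
proof -
  have "{e \<in> F. v \<in> en e} = {}" using assms by (auto simp: sp_tree_def)
  then show ?thesis unfolding dg_def by (metis card.empty)
qed

text \<open>Discharging: vertices of degree at least 8 are so expensive for the average degree, which is
  below 4, that they cannot absorb two edges from every vertex of degree 3.\<close>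

lemma ex_light_vertex:
  assumes "finite V" "finite E" and ends: "\<And>e. e \<in> E \<Longrightarrow> en e \<subseteq> V \<and> card (en e) = 2"
    and min2: "\<And>v. v \<in> V \<Longrightarrow> 2 \<le> dg en E v" and few: "card E + 2 = 2 * card V"
  shows "\<exists>v\<in>V. dg en E v = 2 \<or> dg en E v = 3 \<and>
    card {e \<in> E. v \<in> en e \<and> (\<exists>b\<in>en e. 8 \<le> dg en E b)} \<le> 1"
proof (rule ccontr)
  assume neg: "\<not> ?thesis"
  \<comment> \<open>If the claim fails, every vertex has degree at least 3, and each vertex of
    degree 3 sends at least two edges to vertices of degree 8 or more.\<close>
  then have heavy: "2 \<le> card {e \<in> E. v \<in> en e \<and> (\<exists>b\<in>en e. 8 \<le> dg en E b)}"
    if "v \<in> V" "dg en E v = 3" for v using that by fastforce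
  have ge3: "3 \<le> dg en E v" if "v \<in> V" for v
    using neg min2[OF that] that by (metis Suc_leI le_neq_implies_less numeral_2_eq_2 numeral_3_eq_3)
  define A where "A = {v \<in> V. dg en E v = 3}"
  define B where "B = {v \<in> V. 8 \<le> dg en E v}"
  define M where "M = {e \<in> E. en e \<inter> A \<noteq> {} \<and> en e \<inter> B \<noteq> {}}"
  have fin: "finite A" "finite B" "finite M" using assms by (auto simp: A_def B_def M_def)
  have disj: "A \<inter> B = {}" by (auto simp: A_def B_def)
  \<comment> \<open>The edges between \<open>A\<close> and \<open>B\<close> are counted from both
    sides; each has exactly one end in either set, as the sets are disjoint.\<close>
  have "2 * card A = (\<Sum>v\<in>A. 2)" by simp
  also have "\<dots> \<le> (\<Sum>v\<in>A. dg en M v)"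
  proof (rule sum_mono)
    fix v assume v: "v \<in> A"
    have "{e \<in> E. v \<in> en e \<and> (\<exists>b\<in>en e. 8 \<le> dg en E b)} \<subseteq> {e \<in> M. v \<in> en e}"
      using v ends by (fastforce simp: M_def B_def)
    then have "card {e \<in> E. v \<in> en e \<and> (\<exists>b\<in>en e. 8 \<le> dg en E b)} \<le> dg en M v"
      unfolding dg_def using fin by (intro card_mono) auto
    then show "2 \<le> dg en M v" using heavy[of v] v by (auto simp: A_def)
  qed
  also have "\<dots> = (\<Sum>e\<in>M. card (en e \<inter> A))" using sum_dg fin by blast
  also have "\<dots> \<le> (\<Sum>e\<in>M. card (en e \<inter> B))"
  proof (rule sum_mono)
    fix e assume e: "e \<in> M"
    then have c: "card (en e) = 2" and f: "finite (en e)"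
      using ends[of e] assms(1) finite_subset by (auto simp: M_def)
    have "card (en e \<inter> A) + card (en e \<inter> B) = card ((en e \<inter> A) \<union> (en e \<inter> B))"
      using f disj by (intro card_Un_disjoint[symmetric]) auto
    also have "\<dots> \<le> 2" using c f card_mono[of "en e"] by (metis Int_lower1 Un_least)
    finally have "card (en e \<inter> A) + card (en e \<inter> B) \<le> 2" .
    moreover have "card (en e \<inter> A) \<noteq> 0" "card (en e \<inter> B) \<noteq> 0" using e f by (auto simp: M_def)
    ultimately show "card (en e \<inter> A) \<le> card (en e \<inter> B)" by linarith
  qed
  also have "\<dots> = (\<Sum>v\<in>B. dg en M v)" using sum_dg fin by metis
  also have "\<dots> \<le> (\<Sum>v\<in>B. dg en E v)"
    using assms(2) by (intro sum_mono dg_mono) (auto simp: M_def)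
  finally have AB: "2 * card A \<le> (\<Sum>v\<in>B. dg en E v)" .
  have "(\<Sum>v\<in>V. dg en E v) = 2 * card E"
  proof -
    have "card (en e \<inter> V) = 2" if "e \<in> E" for e using ends[OF that] by (simp add: Int_absorb2)
    then show ?thesis using sum_dg[OF assms(1,2), of en] by simp
  qed
  \<comment> \<open>The degrees sum to \<open>4 * card V - 4\<close>, so the charges
    \<open>dg en E v - 4\<close> total \<open>-4\<close>; they are doubled to avoid halves.\<close>
  then have "(\<Sum>v\<in>V. 2 * (int (dg en E v) - 4)) = - 8"
    using few by (simp add: sum_subtractf flip: sum_distrib_left of_nat_sum)
  \<comment> \<open>The doubled charge is \<open>-2\<close> at degree 3, nonnegative at degrees 4 to
    7, and at least \<open>d\<close> at degree \<open>d\<close> once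
    \<open>2 * (d - 4) \<ge> d\<close>, which is where the threshold 8 comes from. With
    \<open>AB\<close> the total would be nonnegative.\<close>
  moreover have "(\<Sum>v\<in>V. (if v \<in> A then -2 else 0) + (if v \<in> B then int (dg en E v) else 0))
      \<le> (\<Sum>v\<in>V. 2 * (int (dg en E v) - 4))"
  proof (rule sum_mono)
    fix v assume "v \<in> V"
    then show "(if v \<in> A then -2 else 0) + (if v \<in> B then int (dg en E v) else 0)
        \<le> 2 * (int (dg en E v) - 4)"
      using ge3[of v] by (auto simp: A_def B_def)
  qed
  moreover have "(\<Sum>v\<in>V. (if v \<in> A then -2 else 0) + (if v \<in> B then int (dg en E v) else 0))
      = - 2 * int (card A) + (\<Sum>v\<in>B. int (dg en E v))"
  proof -
    have "V \<inter> A = A" "V \<inter> B = B" by (auto simp: A_def B_def)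
    then show ?thesis using assms(1) by (simp add: sum.distrib flip: sum.inter_restrict)
  qed
  ultimately show False using AB by (simp flip: of_nat_sum)
qed

section \<open>Local operations on spanning trees\<close>

lemma sp_tree_add_leaf:
  assumes "sp_tree V en F" "v \<notin> V" "x \<in> V" "en e = {v, x}" "e \<notin> F"
  shows "sp_tree (insert v V) en (insert e F)"
proof -
  have "card (en e) = 2" using assms(2,3,4) by (auto simp: card_2_iff)
  then show ?thesis
    using assms cut_connected_add_leaf[of V en F v x e] by (auto simp: sp_tree_def)
qed

lemma sp_tree_remove_leaf:
  assumes "sp_tree V en F" "v \<in> V" "dg en F v = 1"
  obtains e w where "e \<in> F" "{g \<in> F. v \<in> en g} = {e}" "en e = {v, w}" "w \<in> V - {v}"
    "sp_tree (V - {v}) en (F - {e})"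
proof -
  obtain e where e: "{g \<in> F. v \<in> en g} = {e}"
    using assms(3) unfolding dg_def by (auto simp: card_1_singleton_iff)
  then have eF: "e \<in> F" "v \<in> en e" by blast+
  then obtain w where w: "en e = {v, w}" "w \<in> V - {v}"
    using assms(1) by (fastforce simp: sp_tree_def card_2_iff)
  have "cut_connected (V - {v}) en (F - {e})"
    using assms(1,2) e w by (intro cut_connected_remove_leaf[of V en F v w]) (auto simp: sp_tree_def)
  moreover have "\<forall>g\<in>F - {e}. en g \<subseteq> V - {v} \<and> card (en g) = 2"
    using assms(1) e by (auto simp: sp_tree_def)
  moreover have "card (F - {e}) + 1 = card (V - {v})"
    using assms(1,2) eF card_Suc_Diff1[of F e] card_Suc_Diff1[of V v] by (auto simp: sp_tree_def)
  ultimately have "sp_tree (V - {v}) en (F - {e})" using assms(1) w by (auto simp: sp_tree_def)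
  then show ?thesis using that eF e w by blast
qed

text \<open>Only connectedness has to be supplied, since the edge count drops by one together with
  the vertex count. If \<open>s = t\<close>, the new edge would cross no cut, and
  \<open>F - {p, q}\<close> would connect \<open>V - {v}\<close> with one edge too few.\<close>

lemma sp_tree_replace:
  assumes T: "sp_tree V en F" and v: "v \<in> V" "{g \<in> F. v \<in> en g} = {p, q}" "p \<noteq> q"
    and st: "s \<in> V - {v}" "t \<in> V - {v}"
    and cut: "cut_connected (V - {v}) (en(q := {s, t})) (F - {p})"
  shows "s \<noteq> t" "sp_tree (V - {v}) (en(q := {s, t})) (F - {p})"
proof -
  let ?W = "V - {v}" and ?en = "en(q := {s, t})"
  have pq: "p \<in> F" "q \<in> F" using v by blast+
  have fin: "finite V" "finite F" "card F + 1 = card V" using T by (auto simp: sp_tree_def)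
  have ends: "en g \<subseteq> ?W \<and> card (en g) = 2" if "g \<in> F - {p, q}" for g
    using T v that by (auto simp: sp_tree_def)
  have cW: "card ?W = card F" using fin v(1) card_Suc_Diff1[of V v] by simp
  show ne: "s \<noteq> t"
  proof
    assume "s = t"
    have cut': "cut_connected ?W en (F - {p, q})"
    proof (rule cut_connectedI)
      fix X assume "X \<subseteq> ?W" "X \<noteq> {}" "X \<noteq> ?W"
      then obtain g where g: "g \<in> F - {p}" "?en g \<inter> X \<noteq> {}" "?en g \<inter> (?W - X) \<noteq> {}"
        using cut_connectedD[OF cut] by metis
      then have "g \<noteq> q" using \<open>s = t\<close> by auto
      then show "\<exists>e\<in>F - {p, q}. en e \<inter> X \<noteq> {} \<and> en e \<inter> (?W - X) \<noteq> {}"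
        using g by (intro bexI[of _ g]) auto
    qed
    have "card ?W \<le> card (F - {p, q}) + 1"
      by (rule cut_connected_card_le[OF cut']) (use fin ends st in auto)
    moreover have "card (F - {p, q}) + 2 = card F"
      using pq v(3) fin card_mono[of F "{p, q}"] by (simp add: card_Diff_subset)
    ultimately show False using cW by simp
  qed
  have "\<forall>g\<in>F - {p}. ?en g \<subseteq> ?W \<and> card (?en g) = 2"
    using ends st ne by auto
  then show "sp_tree ?W ?en (F - {p})"
    using cut cW fin pq(1) st card_Suc_Diff1[of F p] unfolding sp_tree_def by auto
qed

lemma sp_tree_subdivide:
  assumes T: "sp_tree V (en(q := {a, b})) F" and "q \<in> F" "p \<notin> F" "en p = {v, a}" "en q = {v, b}" "v \<notin> V"
  shows "sp_tree (insert v V) en (insert p F)"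
proof -
  have ab: "a \<in> V" "b \<in> V" using T assms(2) unfolding sp_tree_def by fastforce+
  have "cut_connected (insert v V) en (insert p F)"
    using cut_connected_subdivide[of V en q a b F p v] assms ab by (auto simp: sp_tree_def)
  moreover have "en g \<subseteq> insert v V \<and> card (en g) = 2" if "g \<in> insert p F" for g
  proof (cases "g = p \<or> g = q")
    case True
    then show ?thesis using assms(4-6) ab by (auto simp: card_2_iff)
  next
    case False
    then have "g \<in> F" using that by simp
    then have "(en(q := {a, b})) g \<subseteq> V \<and> card ((en(q := {a, b})) g) = 2"
      using T unfolding sp_tree_def by blast
    then show ?thesis using False by auto
  qed
  ultimately show ?thesis using T assms(3,6) by (auto simp: sp_tree_def)
qed

section \<open>Balanced signs\<close>

text \<open>A signed pair is an oriented edge, and \<open>f v\<close> is the out-degree minus the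
  in-degree of \<open>v\<close>; the set collects these functions for all orientations of the
  multigraph \<open>A\<close>.\<close>

fun signings :: "('v \<times> 'v) list \<Rightarrow> ('v \<Rightarrow> int) set" where
  "signings [] = {\<lambda>_. 0}"
| "signings (p # A) = (\<Union>f\<in>signings A. \<Union>s\<in>{1, -1}.
     {\<lambda>v. f v + s * (of_bool (v = fst p) - of_bool (v = snd p))})"

lemma signings_ConsI:
  assumes "f \<in> signings A" "s = 1 \<or> s = -1"
    "\<And>v. g v = f v + s * (of_bool (v = fst p) - of_bool (v = snd p))"
  shows "g \<in> signings (p # A)"
proof -
  have "g = (\<lambda>v. f v + s * (of_bool (v = fst p) - of_bool (v = snd p)))" using assms(3) by blast
  then show ?thesis using assms(1,2) unfolding signings.simps by blast
qed

lemma signings_ConsE: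
  assumes "g \<in> signings (p # A)"
  obtains f s where "f \<in> signings A" "s = 1 \<or> s = -1"
    "\<And>v. g v = f v + s * (of_bool (v = fst p) - of_bool (v = snd p))"
proof -
  obtain f s where "f \<in> signings A" "s \<in> {1, -1}"
    "g = (\<lambda>v. f v + s * (of_bool (v = fst p) - of_bool (v = snd p)))"
    using assms unfolding signings.simps by blast
  then show thesis by (intro that[of f s]) auto
qed

declare signings.simps(2)[simp del]

text \<open>The reversal is absorbed by negating the sign.\<close>

lemma signings_flip: "g \<in> signings ((x, y) # A) \<Longrightarrow> g \<in> signings ((y, x) # A)"
  by (erule signings_ConsE, rule_tac s = "-s" in signings_ConsI) (auto simp: algebra_simps)

lemma signings_swap: "g \<in> signings (p # q # A) \<Longrightarrow> g \<in> signings (q # p # A)"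
proof (elim signings_ConsE)
  fix f s h r
  assume *: "f \<in> signings A" "s = 1 \<or> s = -1" "r = 1 \<or> r = -1"
    "\<And>v. h v = f v + s * (of_bool (v = fst q) - of_bool (v = snd q))"
    "\<And>v. g v = h v + r * (of_bool (v = fst p) - of_bool (v = snd p))"
  have "(\<lambda>v. f v + r * (of_bool (v = fst p) - of_bool (v = snd p))) \<in> signings (p # A)"
    by (rule signings_ConsI[OF *(1,3)]) simp
  then show ?thesis using * by (rule_tac signings_ConsI[OF _ *(2)]) auto
qed

lemma signings_Cons_mono:
  assumes "\<And>f. f \<in> signings A \<Longrightarrow> f \<in> signings B" "g \<in> signings (p # A)"
  shows "g \<in> signings (p # B)"
  using assms by (metis signings_ConsE signings_ConsI)

lemma signings_front: "g \<in> signings (p # A @ B) \<Longrightarrow> g \<in> signings (A @ p # B)"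
proof (induction A arbitrary: g)
  case (Cons q A)
  then have "g \<in> signings (q # p # A @ B)" using signings_swap by simp
  then show ?case using signings_Cons_mono[OF Cons.IH] by simp
qed simp

lemma signings_zero:
  "f \<in> signings A \<Longrightarrow> (\<And>p. p \<in> set A \<Longrightarrow> fst p \<noteq> v \<and> snd p \<noteq> v) \<Longrightarrow> f v = 0"
proof (induction A arbitrary: f)
  case (Cons p A)
  obtain g s where g: "g \<in> signings A" "f v = g v + s * (of_bool (v = fst p) - of_bool (v = snd p))"
    using signings_ConsE[OF Cons.prems(1)] by metis
  have "g v = 0" using Cons.IH[OF g(1)] Cons.prems(2) by simp
  moreover have "fst p \<noteq> v" "snd p \<noteq> v" using Cons.prems(2)[of p] by auto
  ultimately show ?case using g(2) by auto
qed simp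

text \<open>Two pairs sharing a vertex, read as \<open>(x, y)\<close> and \<open>(y, w)\<close>, are
  merged into \<open>(x, w)\<close>: giving both the sign of the merged pair cancels their
  contributions at \<open>y\<close>. A pair that meets no other pair only changes values that were
  0.\<close>

lemma ex_balanced_signing:
  fixes A :: "('v \<times> 'v) list"
  shows "\<exists>f\<in>signings A. \<forall>v. \<bar>f v\<bar> \<le> 1"
proof (induction "length A" arbitrary: A rule: less_induct)
  case less
  have merge: "\<exists>f\<in>signings ((x, y) # A'). \<forall>v. \<bar>f v\<bar> \<le> 1"
    if A': "A' = A1 @ p # A2" "p = (y, w) \<or> p = (w, y)" and len: "length A = Suc (length A')"
    for x y w :: 'v and A' A1 A2 p
  proof -
    obtain g where g: "g \<in> signings ((x, w) # A1 @ A2)" "\<forall>v. \<bar>g v\<bar> \<le> 1"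
      using less[of "(x, w) # A1 @ A2"] A' len by auto
    obtain f s where f: "f \<in> signings (A1 @ A2)" "s = 1 \<or> s = -1"
      "\<And>v. g v = f v + s * (of_bool (v = x) - of_bool (v = w))"
      using signings_ConsE[OF g(1)] by (metis fst_conv snd_conv)
    have "(\<lambda>v. f v + s * (of_bool (v = y) - of_bool (v = w))) \<in> signings ((y, w) # A1 @ A2)"
      by (rule signings_ConsI[OF f(1,2)]) simp
    then have "(\<lambda>v. f v + s * (of_bool (v = y) - of_bool (v = w))) \<in> signings (p # A1 @ A2)"
      using A'(2) signings_flip by metis
    then have "(\<lambda>v. f v + s * (of_bool (v = y) - of_bool (v = w))) \<in> signings A'"
      using signings_front A'(1) by metis
    then have "g \<in> signings ((x, y) # A')"
      by (rule signings_ConsI[OF _ f(2)]) (simp add: f(3) algebra_simps)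
    then show ?thesis using g(2) by blast
  qed
  show ?case
  proof (cases A)
    case Nil
    then show ?thesis by simp
  next
    case (Cons a A')
    obtain x y where a: "a = (x, y)" by (cases a)
    show ?thesis
    proof (cases "\<exists>p\<in>set A'. fst p \<in> {x, y} \<or> snd p \<in> {x, y}")
      case False
      obtain f where f: "f \<in> signings A'" "\<forall>v. \<bar>f v\<bar> \<le> 1" using less[of A'] Cons by auto
      have z: "f x = 0" "f y = 0" using signings_zero[OF f(1)] False by auto
      have "(\<lambda>v. f v + 1 * (of_bool (v = x) - of_bool (v = y))) \<in> signings A"
        unfolding Cons a by (rule signings_ConsI[OF f(1)]) auto
      moreover have "\<forall>v. \<bar>f v + 1 * (of_bool (v = x) - of_bool (v = y))\<bar> \<le> 1"
        using f(2) z by (auto simp: of_bool_def)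
      ultimately show ?thesis by (intro bexI)
    next
      case True
      then obtain p where p: "p \<in> set A'" "fst p \<in> {x, y} \<or> snd p \<in> {x, y}" by blast
      then obtain A1 A2 where A': "A' = A1 @ p # A2" by (meson split_list)
      have "\<exists>w. p = (y, w) \<or> p = (w, y) \<or> p = (x, w) \<or> p = (w, x)" using p(2) by (cases p) auto
      then consider w where "p = (y, w) \<or> p = (w, y)" | w where "p = (x, w) \<or> p = (w, x)" by blast
      then show ?thesis
      proof cases
        case 1
        then show ?thesis using merge[OF A'] Cons a by simp
      next
        case 2
        \<comment> \<open>A shared \<open>x\<close> is reduced to a shared \<open>y\<close> by
          reversing the first pair.\<close>
        then have "\<exists>f\<in>signings ((y, x) # A'). \<forall>v. \<bar>f v\<bar> \<le> 1" using merge[OF A'] Cons by simp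
        then show ?thesis using signings_flip Cons a by metis
      qed
    qed
  qed
qed

section \<open>Balancing two edge-disjoint spanning trees\<close>

text \<open>Bounds the number of shifts of a vertex of degree \<open>d\<close>: each shift happens at degree at most 7,
  lowers the degree by 1, and leaves degree at least 2. The subtraction is truncated.\<close>

definition slack :: "nat \<Rightarrow> int" where
  "slack d = int (min (d - 2) 5)"

lemma slack_mono: "d \<le> d' \<Longrightarrow> slack d \<le> slack d'"
  by (auto simp: slack_def)

lemma slack_Suc: "2 \<le> d \<Longrightarrow> d \<le> 6 \<Longrightarrow> slack (Suc d) = slack d + 1"
  by (auto simp: slack_def)

text \<open>A vertex \<open>v\<close> of degree 3 with incident edges \<open>p\<close>, \<open>q\<close>, \<open>r\<close> is eliminated by joining the
  other ends of \<open>p\<close> and \<open>q\<close>; the edge \<open>q\<close> is reused for the new edge. Only the other end of \<open>r\<close>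
  loses a degree, and there are two choices for \<open>r\<close>.\<close>

lemma eliminate_degree_3:
  assumes R: "sp_tree V en R" and B: "sp_tree V en B" and disj: "R \<inter> B = {}" and v: "v \<in> V"
    and d: "dg en R v = 2" "dg en B v = 1"
    and light: "card {e \<in> R \<union> B. v \<in> en e \<and> (\<exists>b\<in>en e. P b)} \<le> 1"
  obtains p q r x y z R1 B1 where "p \<in> R \<union> B" "q \<in> R \<union> B" "r \<in> R \<union> B" "p \<noteq> q" "p \<noteq> r" "q \<noteq> r"
    "en p = {v, x}" "en q = {v, y}" "en r = {v, z}" "\<not> P z" "z \<in> V - {v}" "x \<in> V - {v}" "y \<in> V - {v}"
    "x \<noteq> y" "sp_tree (V - {v}) (en(q := {x, y})) R1" "sp_tree (V - {v}) (en(q := {x, y})) B1"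
    "R1 \<inter> B1 = {}" "R1 \<union> B1 = R \<union> B - {p, r}"
proof -
  obtain p q where pq: "{e \<in> R. v \<in> en e} = {p, q}" "p \<noteq> q"
    using d(1) unfolding dg_def by (auto simp: card_2_iff)
  then have pqR: "p \<in> R" "q \<in> R" "v \<in> en p" "v \<in> en q" by blast+
  have ends: "\<And>e. e \<in> R \<Longrightarrow> en e \<subseteq> V \<and> card (en e) = 2" using R by (auto simp: sp_tree_def)
  obtain a where a: "en p = {v, a}" "a \<in> V - {v}"
    using ends[OF pqR(1)] pqR(3) by (fastforce simp: card_2_iff)
  obtain b where b: "en q = {v, b}" "b \<in> V - {v}"
    using ends[OF pqR(2)] pqR(4) by (fastforce simp: card_2_iff)
  obtain r c where r: "r \<in> B" "en r = {v, c}" "c \<in> V - {v}" "sp_tree (V - {v}) en (B - {r})"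
    using sp_tree_remove_leaf[OF B v d(2)] by metis
  have only: "\<And>g. g \<in> R \<Longrightarrow> v \<in> en g \<Longrightarrow> g = p \<or> g = q" using pq(1) by blast
  have cutR: "cut_connected V en R" using R by (simp add: sp_tree_def)
  have pqB: "p \<notin> B" "q \<notin> B" "p \<noteq> r" "q \<noteq> r" "r \<notin> R" using pqR r(1) disj by blast+
  have B': "sp_tree (V - {v}) (en(s := X)) (B - {r})" if "s \<in> R" for s X
    using r(4) sp_tree_fun_upd[of s "B - {r}"] that disj by auto
  have sets: "(R - {s}) \<inter> (B - {r}) = {}" "(R - {s}) \<union> (B - {r}) = R \<union> B - {s, r}"
    "(R - {s}) \<union> (B - {r}) = R \<union> B - {r, s}" if "s \<in> R" for s
    using disj r(1) that pqB by auto
  show ?thesis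
  proof (cases "P c")
    case False
    \<comment> \<open>Both \<open>p\<close> and \<open>q\<close> lie in \<open>R\<close>, so they
      are joined directly, and the leaf edge \<open>r\<close> of \<open>B\<close> is the one
      dropped.\<close>
    have cut: "cut_connected (V - {v}) (en(q := {a, b})) (R - {p})"
      using cut_connected_smooth[OF cutR v a(2) b(2) pqR(1,2) pq(2) a(1) b(1) only] .
    note R' = sp_tree_replace[OF R v pq a(2) b(2) cut]
    show ?thesis
      by (rule that[of p q r a b c, OF _ _ _ _ _ _ a(1) b(1) r(2) False r(3) a(2) b(2) R' B' sets(1,2)])
        (use pqR r(1) pq(2) pqB in auto)
  next
    case True
    \<comment> \<open>The edge \<open>r\<close> already uses up the one edge that may lead to
      \<open>P\<close>, so either edge of \<open>R\<close> qualifies as the dropped one; at least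
      one of the two choices keeps \<open>R\<close> a tree when the new edge ends in
      \<open>c\<close>.\<close>
    have small: "\<not> P w" if "s \<in> {p, q}" "en s = {v, w}" for s w
    proof
      assume "P w"
      have sub: "{r, s} \<subseteq> {e \<in> R \<union> B. v \<in> en e \<and> (\<exists>b\<in>en e. P b)}"
        using that \<open>P w\<close> \<open>P c\<close> pqR r by auto
      have fin: "finite {e \<in> R \<union> B. v \<in> en e \<and> (\<exists>b\<in>en e. P b)}"
        using R B by (auto simp: sp_tree_def)
      have "card {r, s} \<le> 1" using order_trans[OF card_mono[OF fin sub] light] .
      then show False using that pqB by auto
    qed
    consider "cut_connected (V - {v}) (en(q := {b, c})) (R - {p})"
      | "cut_connected (V - {v}) (en(p := {a, c})) (R - {q})"
      using cut_connected_smooth_third[OF cutR v a(2) b(2) r(3) pqR(1,2) pq(2) a(1) b(1) only] by blast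
    then show ?thesis
    proof cases
      case 1
      note R' = sp_tree_replace[OF R v pq b(2) r(3) 1]
      have eq: "{b, c} = {c, b}" by blast
      show ?thesis
        by (rule that[of r q p c b a, OF _ _ _ _ _ _ r(2) b(1) a(1) small a(2) r(3) b(2)
              not_sym[OF R'(1)] R'(2)[unfolded eq] B' sets(1,3)])
          (use pqR r(1) pq(2) pqB a(1) in auto)
    next
      case 2
      have qp: "{e \<in> R. v \<in> en e} = {q, p}" using pq(1) by blast
      note R' = sp_tree_replace[OF R v qp not_sym[OF pq(2)] a(2) r(3) 2]
      have eq: "{a, c} = {c, a}" by blast
      show ?thesis
        by (rule that[of r p q c a b, OF _ _ _ _ _ _ r(2) a(1) b(1) small b(2) r(3) a(2)
              not_sym[OF R'(1)] R'(2)[unfolded eq] B' sets(1,3)])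
          (use pqR r(1) pq(2) pqB b(1) in auto)
    qed
  qed
qed

text \<open>The conclusion does not say which of the two trees contains the new edge, so the other
  colour pattern follows by exchanging \<open>R\<close> and \<open>B\<close>.\<close>

lemma eliminate_degree_3_sym:
  assumes R: "sp_tree V en R" and B: "sp_tree V en B" and disj: "R \<inter> B = {}" and v: "v \<in> V"
    and d: "dg en R v = 2 \<and> dg en B v = 1 \<or> dg en B v = 2 \<and> dg en R v = 1"
    and light: "card {e \<in> R \<union> B. v \<in> en e \<and> (\<exists>b\<in>en e. P b)} \<le> 1"
  obtains p q r x y z R1 B1 where "p \<in> R \<union> B" "q \<in> R \<union> B" "r \<in> R \<union> B" "p \<noteq> q" "p \<noteq> r" "q \<noteq> r"
    "en p = {v, x}" "en q = {v, y}" "en r = {v, z}" "\<not> P z" "z \<in> V - {v}" "x \<in> V - {v}" "y \<in> V - {v}"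
    "x \<noteq> y" "sp_tree (V - {v}) (en(q := {x, y})) R1" "sp_tree (V - {v}) (en(q := {x, y})) B1"
    "R1 \<inter> B1 = {}" "R1 \<union> B1 = R \<union> B - {p, r}"
  using d
proof
  assume d: "dg en R v = 2 \<and> dg en B v = 1"
  show thesis
    by (rule eliminate_degree_3[OF R B disj v conjunct1[OF d] conjunct2[OF d] light]) (rule that)
next
  assume d: "dg en B v = 2 \<and> dg en R v = 1"
  have disj': "B \<inter> R = {}" using disj by blast
  have light': "card {e \<in> B \<union> R. v \<in> en e \<and> (\<exists>b\<in>en e. P b)} \<le> 1"
    using light unfolding Un_commute[of B R] .
  show thesis
    by (rule eliminate_degree_3[OF B R disj' v conjunct1[OF d] conjunct2[OF d] light',
          unfolded Un_commute[of B R]])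
      (rule that)
qed

text \<open>Undoes the elimination: the tree holding \<open>q\<close> is subdivided by
  \<open>v\<close>, which leaves the degrees of \<open>x\<close> and \<open>y\<close> alone, and the
  other tree gets the leaf edge \<open>r\<close>. Hence besides \<open>v\<close> only
  \<open>z\<close> gains a degree.\<close>

lemma restore_degree_3:
  assumes R: "sp_tree W (en(q := {x, y})) R" and B: "sp_tree W (en(q := {x, y})) B"
    and "q \<in> R" "q \<notin> B" "p \<notin> R" "r \<notin> B" "p \<noteq> q" "q \<noteq> r"
    and "en p = {v, x}" "en q = {v, y}" "en r = {v, z}" "v \<notin> W" "z \<in> W" "x \<noteq> y"
  shows "sp_tree (insert v W) en (insert p R)" "sp_tree (insert v W) en (insert r B)"
    "dg en (insert p R) u = dg (en(q := {x, y})) R u + (if u = v then 2 else 0)"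
    "dg en (insert r B) u = dg (en(q := {x, y})) B u + (if u = v \<or> u = z then 1 else 0)"
proof -
  let ?en = "en(q := {x, y})"
  have xy: "x \<in> W" "y \<in> W" using R assms(3) unfolding sp_tree_def by fastforce+
  have fin: "finite R" "finite B" using R B by (auto simp: sp_tree_def)
  show "sp_tree (insert v W) en (insert p R)"
    using sp_tree_subdivide[OF R assms(3,5,9,10,12)] .
  have "sp_tree W en B"
    using B sp_tree_fun_upd[OF assms(4)] by metis
  then show "sp_tree (insert v W) en (insert r B)"
    using sp_tree_add_leaf assms(6,11-13) by metis
  obtain R0 where R0: "R = insert q R0" "q \<notin> R0" using assms(3) by (meson mk_disjoint_insert)
  have "dg ?en R0 u = dg en R0 u" using R0 by (intro dg_cong) auto
  then show "dg en (insert p R) u = dg ?en R u + (if u = v then 2 else 0)"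
    using R0 fin assms(5,7,9,10,12,14) xy by (auto simp: dg_insert)
  have "dg ?en B u = dg en B u" using assms(4) by (intro dg_cong) auto
  then show "dg en (insert r B) u = dg ?en B u + (if u = v \<or> u = z then 1 else 0)"
    using fin assms(6,11) by (auto simp: dg_insert)
qed

text \<open>The list \<open>A\<close> records the decisions still to be made: an eliminated vertex of degree 2 with
  neighbours \<open>x\<close> and \<open>y\<close> contributes a sign to the imbalance of \<open>x\<close> and the opposite sign to that of \<open>y\<close>, and the
  choice is free.\<close>

lemma double_tree_signed_balance:
  fixes V :: "'v set" and en :: "'e \<Rightarrow> 'v set"
  assumes "sp_tree V en R" "sp_tree V en B" "R \<inter> B = {}"
  shows "\<exists>R' B' f. sp_tree V en R' \<and> sp_tree V en B' \<and> R' \<inter> B' = {} \<and> R' \<union> B' = R \<union> B \<and>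
    f \<in> signings A \<and> (\<forall>u. \<bar>int (dg en R' u) - int (dg en B' u) + f u\<bar> \<le> 1 + slack (dg en (R \<union> B) u))"
  using assms
proof (induction "card V" arbitrary: V en R B A rule: less_induct)
  case less
  note R = less.prems(1) and B = less.prems(2) and disj = less.prems(3)
  let ?E = "R \<union> B"
  have fin: "finite V" "V \<noteq> {}" "finite R" "finite B" using R B by (auto simp: sp_tree_def)
  show ?case
  proof (cases "2 \<le> card V")
    case False
    moreover have "card V \<noteq> 0" using fin by simp
    ultimately have "card V = 1" by linarith
    then have "R = {}" "B = {}" using R B by (auto simp: sp_tree_def)
    \<comment> \<open>A single vertex has no edges, so only the pending decisions must be balanced;
      the constant 1 of the bound comes from here.\<close>
    moreover obtain f where "f \<in> signings A" "\<forall>v. \<bar>f v\<bar> \<le> 1" using ex_balanced_signing by metis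
    ultimately show ?thesis using R by (intro exI[of _ "{}"] exI[of _ f]) (auto simp: dg_def slack_def)
  next
    case True
    have dE: "dg en ?E u = dg en R u + dg en B u" for u using dg_union_disjoint fin(3,4) disj by metis
    have pos: "1 \<le> dg en R u" "1 \<le> dg en B u" if "u \<in> V" for u
      using sp_tree_dg_pos[OF _ True that] R B by auto
    have cE: "card ?E + 2 = 2 * card V"
      using card_Un_disjoint[OF fin(3,4) disj] R B by (auto simp: sp_tree_def)
    \<comment> \<open>The threshold 8 matches \<open>slack\<close>, whose last increase is from
      degree 6 to degree 7.\<close>
    have "\<exists>v\<in>V. dg en ?E v = 2 \<or> dg en ?E v = 3 \<and>
      card {e \<in> ?E. v \<in> en e \<and> (\<exists>b\<in>en e. 8 \<le> dg en ?E b)} \<le> 1"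
    proof (rule ex_light_vertex[OF fin(1) _ _ _ cE])
      show "finite ?E" using fin by simp
      show "en e \<subseteq> V \<and> card (en e) = 2" if "e \<in> ?E" for e using that R B by (auto simp: sp_tree_def)
      show "2 \<le> dg en ?E u" if "u \<in> V" for u using pos[OF that] dE[of u] by simp
    qed
    then obtain v where v: "v \<in> V" and cases: "dg en ?E v = 2 \<or> dg en ?E v = 3 \<and>
      card {e \<in> ?E. v \<in> en e \<and> (\<exists>b\<in>en e. 8 \<le> dg en ?E b)} \<le> 1" by blast
    define W where "W = V - {v}"
    have W: "card W < card V" "v \<notin> W" "insert v W = V"
      using v fin card_Diff1_less[of V v] by (auto simp: W_def)
    from cases show ?thesis
    proof
      assume "dg en ?E v = 2"
      then have d1: "dg en R v = 1" "dg en B v = 1" using dE[of v] pos[OF v] by auto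
      obtain e x where e: "e \<in> R" "en e = {v, x}" "x \<in> W" "sp_tree W en (R - {e})"
        using sp_tree_remove_leaf[OF R v d1(1)] unfolding W_def by metis
      obtain g y where g: "g \<in> B" "en g = {v, y}" "y \<in> W" "sp_tree W en (B - {g})"
        using sp_tree_remove_leaf[OF B v d1(2)] unfolding W_def by metis
      have un: "(R - {e}) \<union> (B - {g}) = ?E - {e, g}" using disj e(1) g(1) by blast
      \<comment> \<open>Which tree gets \<open>e\<close> and which gets \<open>g\<close> is
        postponed as the pair \<open>(x, y)\<close>; the sign found by induction decides it, and
        either assignment attaches a leaf to both trees.\<close>
      have "\<exists>R' B' f. sp_tree W en R' \<and> sp_tree W en B' \<and> R' \<inter> B' = {} \<and> R' \<union> B' = ?E - {e, g} \<and>
          f \<in> signings ((x, y) # A) \<and> (\<forall>u. \<bar>int (dg en R' u) - int (dg en B' u) + f u\<bar>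
            \<le> 1 + slack (dg en (?E - {e, g}) u))"
        using less.hyps[OF W(1) e(4) g(4), of "(x, y) # A"] disj un by auto
      then obtain R1 B1 f1 where IH: "sp_tree W en R1" "sp_tree W en B1" "R1 \<inter> B1 = {}"
        "R1 \<union> B1 = ?E - {e, g}" "f1 \<in> signings ((x, y) # A)"
        "\<And>u. \<bar>int (dg en R1 u) - int (dg en B1 u) + f1 u\<bar> \<le> 1 + slack (dg en (?E - {e, g}) u)"
        by blast
      obtain f s where f: "f \<in> signings A" "s = 1 \<or> s = -1"
        "\<And>u. f1 u = f u + s * (of_bool (u = x) - of_bool (u = y))"
        using signings_ConsE[OF IH(5)] by (metis fst_conv snd_conv)
      have slack: "slack (dg en (?E - {e, g}) u) \<le> slack (dg en ?E u)" for u
        using fin by (intro slack_mono dg_mono) auto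
      have fin1: "finite R1" "finite B1" using IH(1,2) by (auto simp: sp_tree_def)
      have new: "e \<notin> R1" "e \<notin> B1" "g \<notin> R1" "g \<notin> B1" "e \<noteq> g" using IH(4) e(1) g(1) disj by blast+
      have leaf: "sp_tree V en (insert e R1)" "sp_tree V en (insert g B1)"
        "sp_tree V en (insert g R1)" "sp_tree V en (insert e B1)"
        using sp_tree_add_leaf[OF _ W(2)] e(2,3) g(2,3) IH(1,2) new W(3) by metis+
      have xy: "x \<noteq> v" "y \<noteq> v" using W(2) e(3) g(3) by auto
      from f(2) show ?thesis
      proof
        assume s: "s = 1"
        have eq: "int (dg en (insert e R1) u) - int (dg en (insert g B1) u) + f u
            = int (dg en R1 u) - int (dg en B1 u) + f1 u" for u
          using fin1 new f(3)[of u] s e(2) g(2) xy by (auto simp: dg_insert)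
        have "\<bar>int (dg en (insert e R1) u) - int (dg en (insert g B1) u) + f u\<bar>
            \<le> 1 + slack (dg en ?E u)" for u using eq[of u] IH(6)[of u] slack[of u] by linarith
        moreover have "insert e R1 \<inter> insert g B1 = {}" "insert e R1 \<union> insert g B1 = ?E"
          using IH(3,4) new e(1) g(1) by blast+
        ultimately show ?thesis using leaf(1,2) f(1)
          by (intro exI[of _ "insert e R1"] exI[of _ "insert g B1"] exI[of _ f]) simp
      next
        assume s: "s = -1"
        have eq: "int (dg en (insert g R1) u) - int (dg en (insert e B1) u) + f u
            = int (dg en R1 u) - int (dg en B1 u) + f1 u" for u
          using fin1 new f(3)[of u] s e(2) g(2) xy by (auto simp: dg_insert)
        have "\<bar>int (dg en (insert g R1) u) - int (dg en (insert e B1) u) + f u\<bar>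
            \<le> 1 + slack (dg en ?E u)" for u using eq[of u] IH(6)[of u] slack[of u] by linarith
        moreover have "insert g R1 \<inter> insert e B1 = {}" "insert g R1 \<union> insert e B1 = ?E"
          using IH(3,4) new e(1) g(1) by blast+
        ultimately show ?thesis using leaf(3,4) f(1)
          by (intro exI[of _ "insert g R1"] exI[of _ "insert e B1"] exI[of _ f]) simp
      qed
    next
      assume deg3: "dg en ?E v = 3 \<and>
        card {e \<in> ?E. v \<in> en e \<and> (\<exists>b\<in>en e. 8 \<le> dg en ?E b)} \<le> 1"
      have d12: "dg en R v = 2 \<and> dg en B v = 1 \<or> dg en B v = 2 \<and> dg en R v = 1"
        using deg3 dE[of v] pos[OF v] by linarith
      obtain p q r x y z R1 B1 where
        pqr: "p \<in> ?E" "q \<in> ?E" "r \<in> ?E" "p \<noteq> q" "p \<noteq> r" "q \<noteq> r"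
          "en p = {v, x}" "en q = {v, y}" "en r = {v, z}"
        and z: "\<not> 8 \<le> dg en ?E z" "z \<in> W" and xy: "x \<in> W" "y \<in> W" "x \<noteq> y"
        and T1: "sp_tree W (en(q := {x, y})) R1" "sp_tree W (en(q := {x, y})) B1"
          "R1 \<inter> B1 = {}" "R1 \<union> B1 = ?E - {p, r}"
        by (rule eliminate_degree_3_sym[OF R B disj v d12 conjunct2[OF deg3], folded W_def])
      let ?en = "en(q := {x, y})"
      have "\<exists>R' B' f. sp_tree W ?en R' \<and> sp_tree W ?en B' \<and> R' \<inter> B' = {} \<and> R' \<union> B' = ?E - {p, r} \<and>
          f \<in> signings A \<and> (\<forall>u. \<bar>int (dg ?en R' u) - int (dg ?en B' u) + f u\<bar>
            \<le> 1 + slack (dg ?en (?E - {p, r}) u))"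
        using less.hyps[OF W(1) T1(1,2,3), of A] T1(4) by simp
      then obtain S T f where IH: "sp_tree W ?en S" "sp_tree W ?en T" "S \<inter> T = {}"
        "S \<union> T = ?E - {p, r}" "f \<in> signings A"
        "\<And>u. \<bar>int (dg ?en S u) - int (dg ?en T u) + f u\<bar> \<le> 1 + slack (dg ?en (?E - {p, r}) u)"
        by blast
      have "card {x, y} \<le> card W" using xy fin by (intro card_mono) (auto simp: W_def)
      then have cW: "2 \<le> card W" using xy(3) by simp
      \<comment> \<open>Stated with a sign \<open>s\<close> because the induction may put
        \<open>q\<close> into either tree; exchanging the trees negates the imbalance.\<close>
      have "\<exists>R' B'. sp_tree V en R' \<and> sp_tree V en B' \<and> R' \<inter> B' = {} \<and> R' \<union> B' = ?E \<and>
        (\<forall>u. \<bar>int (dg en R' u) - int (dg en B' u) + s * f u\<bar> \<le> 1 + slack (dg en ?E u))"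
        if ST: "sp_tree W ?en S" "sp_tree W ?en T" "S \<inter> T = {}" "S \<union> T = ?E - {p, r}" "q \<in> S"
          and bd: "\<And>u. \<bar>int (dg ?en S u) - int (dg ?en T u) + s * f u\<bar> \<le> 1 + slack (dg ?en (?E - {p, r}) u)"
        for S T and s :: int
      proof -
        have new: "q \<notin> T" "p \<notin> S" "r \<notin> T" "p \<notin> T" "r \<notin> S" using ST(3-5) by blast+
        note res = restore_degree_3[OF ST(1,2,5) new(1-3) pqr(4,6-9) W(2) z(2) xy(3)]
        have finST: "finite S" "finite T" using ST by (auto simp: sp_tree_def)
        have un: "insert p S \<union> insert r T = ?E" using ST(4) pqr(1,3) by blast
        have "insert p S \<inter> insert r T = {}" using new ST(3) pqr(5) by blast
        then have dE': "dg en ?E u = dg en (insert p S) u + dg en (insert r T) u" for u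
          using dg_union_disjoint[of "insert p S" "insert r T" en u] finST un by simp
        have dE0: "dg ?en (?E - {p, r}) u = dg ?en S u + dg ?en T u" for u
          using dg_union_disjoint[OF finST ST(3), of ?en u] ST(4) by simp
        have "\<bar>int (dg en (insert p S) u) - int (dg en (insert r T) u) + s * f u\<bar> \<le> 1 + slack (dg en ?E u)" for u
        proof -
          consider "u = v" | "u = z" "u \<noteq> v" | "u \<noteq> v" "u \<noteq> z" by blast
          then show ?thesis
          proof cases
            case 1
            \<comment> \<open>In the smaller graph \<open>v\<close> has degree 0, so
              \<open>s * f v\<close> is bounded by 1; this uses that the bound is claimed for all
              \<open>u\<close>, not only for vertices. The restored imbalance is at most 2, which is
              \<open>1 + slack 3\<close>.\<close>
            have "dg ?en S v = 0" "dg ?en T v = 0" using sp_tree_dg_outside ST(1,2) W(2) by metis+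
            then show ?thesis
              using bd[of v] dE0[of v] dE'[of v] res(3,4)[of v] 1 by (simp add: slack_def)
          next
            case 2
            \<comment> \<open>In the smaller graph \<open>z\<close> has degree 2 to 6, so restoring
              \<open>r\<close> raises its slack by 1, which pays for the shift.\<close>
            have "1 \<le> dg ?en S z" "1 \<le> dg ?en T z" using sp_tree_dg_pos[OF _ cW z(2)] ST by metis+
            moreover have "dg en ?E z = Suc (dg ?en S z + dg ?en T z)"
              using dE'[of z] res(3,4)[of z] 2 by simp
            ultimately have "slack (dg en ?E z) = slack (dg ?en (?E - {p, r}) z) + 1"
              using slack_Suc[of "dg ?en S z + dg ?en T z"] z(1) dE0[of z] by simp
            then show ?thesis using bd[of z] res(3,4)[of z] 2 by simp
          next
            case 3
            then have "dg en ?E u = dg ?en (?E - {p, r}) u"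
              using dE0[of u] dE'[of u] res(3,4)[of u] by simp
            then show ?thesis using bd[of u] res(3,4)[of u] 3 by simp
          qed
        qed
        then show ?thesis using res(1,2)[unfolded W(3)] un \<open>insert p S \<inter> insert r T = {}\<close>
          by (intro exI[of _ "insert p S"] exI[of _ "insert r T"]) simp
      qed
      note restore = this
      have "q \<in> S \<or> q \<in> T" using IH(4) pqr by blast
      then show ?thesis
      proof
        assume "q \<in> S"
        have "\<bar>int (dg ?en S u) - int (dg ?en T u) + 1 * f u\<bar> \<le> 1 + slack (dg ?en (?E - {p, r}) u)" for u
          using IH(6)[of u] by simp
        from restore[OF IH(1-4) \<open>q \<in> S\<close> this]
        obtain R' B' where RB: "sp_tree V en R'" "sp_tree V en B'" "R' \<inter> B' = {}" "R' \<union> B' = ?E"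
          "\<And>u. \<bar>int (dg en R' u) - int (dg en B' u) + 1 * f u\<bar> \<le> 1 + slack (dg en ?E u)" by blast
        have "\<bar>int (dg en R' u) - int (dg en B' u) + f u\<bar> \<le> 1 + slack (dg en ?E u)" for u
          using RB(5)[of u] by simp
        then show ?thesis using RB(1-4) IH(5)
          by (intro exI[of _ R'] exI[of _ B'] exI[of _ f]) simp
      next
        assume "q \<in> T"
        have "\<bar>int (dg ?en T u) - int (dg ?en S u) + (-1) * f u\<bar> \<le> 1 + slack (dg ?en (?E - {p, r}) u)" for u
          using IH(6)[of u] by linarith
        from restore[OF IH(2,1) IH(3,4)[unfolded Int_commute[of S] Un_commute[of S]] \<open>q \<in> T\<close> this]
        obtain R' B' where RB: "sp_tree V en R'" "sp_tree V en B'" "R' \<inter> B' = {}" "R' \<union> B' = ?E"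
          "\<And>u. \<bar>int (dg en R' u) - int (dg en B' u) + (-1) * f u\<bar> \<le> 1 + slack (dg en ?E u)" by blast
        have "\<bar>int (dg en B' u) - int (dg en R' u) + f u\<bar> \<le> 1 + slack (dg en ?E u)" for u
          using RB(5)[of u] by linarith
        then show ?thesis using RB(1-4) IH(5)
          by (intro exI[of _ B'] exI[of _ R'] exI[of _ f]) (simp add: Int_commute Un_commute)
      qed
    qed
  qed
qed

text \<open>With no pending decisions the signing vanishes, and \<open>1 + slack\<close> is at most
  6.\<close>

lemma double_tree_balance:
  assumes "sp_tree V en R" "sp_tree V en B" "R \<inter> B = {}"
  obtains R' B' where "sp_tree V en R'" "sp_tree V en B'" "R' \<inter> B' = {}" "R' \<union> B' = R \<union> B"
    "\<And>u. \<bar>real (dg en R' u) - real (dg en B' u)\<bar> \<le> 6"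
proof -
  obtain R' B' f where *: "sp_tree V en R'" "sp_tree V en B'" "R' \<inter> B' = {}" "R' \<union> B' = R \<union> B"
    "f \<in> signings []" "\<And>u. \<bar>int (dg en R' u) - int (dg en B' u) + f u\<bar> \<le> 1 + slack (dg en (R \<union> B) u)"
    using double_tree_signed_balance[OF assms, of "[]"] by blast
  have "\<bar>real (dg en R' u) - real (dg en B' u)\<bar> \<le> 6" for u
  proof -
    have "f u = 0" using *(5) by simp
    moreover have "slack (dg en (R \<union> B) u) \<le> 5" by (simp add: slack_def)
    ultimately have "dg en R' u \<le> dg en B' u + 6 \<and> dg en B' u \<le> dg en R' u + 6"
      using *(6)[of u] by linarith
    then show ?thesis by linarith
  qed
  then show ?thesis using that * by blast
qed

section \<open>Averaging by repeated pairing\<close>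

lemma average_error:
  fixes x y :: real
  assumes "\<bar>x - a\<bar> \<le> e" "\<bar>y - b\<bar> \<le> e" "x' + y' = x + y" "\<bar>x' - y'\<bar> \<le> 2 * c"
  shows "\<bar>x' - (a + b) / 2\<bar> \<le> e + c" "\<bar>y' - (a + b) / 2\<bar> \<le> e + c"
  using assms by argo+

text \<open>\<open>Q d\<close> says that the degree table \<open>d\<close>, with one row for each tree, is realized by some
  factorization. Two rows can be averaged at every vertex simultaneously, up to an error \<open>c\<close>.\<close>

locale pair_balancing =
  fixes Q :: "(nat \<Rightarrow> 'v \<Rightarrow> real) \<Rightarrow> bool" and I :: "nat set" and c :: real
  assumes c_nonneg: "0 \<le> c"
    and pair: "Q d \<Longrightarrow> i \<in> I \<Longrightarrow> j \<in> I \<Longrightarrow> i \<noteq> j \<Longrightarrow>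
      \<exists>d'. Q d' \<and> (\<forall>l. l \<noteq> i \<longrightarrow> l \<noteq> j \<longrightarrow> d' l = d l) \<and>
        (\<forall>v. d' i v + d' j v = d i v + d j v \<and> \<bar>d' i v - d' j v\<bar> \<le> 2 * c)"
begin

text \<open>The pairs \<open>{i, f i}\<close> are disjoint, so they are balanced one after the other
  without disturbing each other.\<close>

lemma pairs:
  assumes "finite A" "inj_on f A" "A \<subseteq> I" "f ` A \<subseteq> I" "A \<inter> f ` A = {}" "Q d"
  shows "\<exists>d'. Q d' \<and> (\<forall>l. l \<notin> A \<longrightarrow> l \<notin> f ` A \<longrightarrow> d' l = d l) \<and>
    (\<forall>i\<in>A. \<forall>v. d' i v + d' (f i) v = d i v + d (f i) v \<and> \<bar>d' i v - d' (f i) v\<bar> \<le> 2 * c)"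
  using assms
proof (induction A rule: finite_induct)
  case empty
  then show ?case by auto
next
  case (insert a A)
  then obtain d1 where d1: "Q d1" "\<And>l. l \<notin> A \<Longrightarrow> l \<notin> f ` A \<Longrightarrow> d1 l = d l"
    "\<And>i v. i \<in> A \<Longrightarrow> d1 i v + d1 (f i) v = d i v + d (f i) v \<and> \<bar>d1 i v - d1 (f i) v\<bar> \<le> 2 * c"
    by auto
  have a: "a \<in> I" "f a \<in> I" "a \<noteq> f a" "a \<notin> A" "a \<notin> f ` A" "f a \<notin> A" "f a \<notin> f ` A"
    using insert.prems insert.hyps by auto
  obtain d2 where d2: "Q d2" "\<And>l. l \<noteq> a \<Longrightarrow> l \<noteq> f a \<Longrightarrow> d2 l = d1 l"
    "\<And>v. d2 a v + d2 (f a) v = d1 a v + d1 (f a) v \<and> \<bar>d2 a v - d2 (f a) v\<bar> \<le> 2 * c"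
    using pair[OF d1(1) a(1-3)] by blast
  have "d2 i v + d2 (f i) v = d i v + d (f i) v \<and> \<bar>d2 i v - d2 (f i) v\<bar> \<le> 2 * c"
    if "i \<in> insert a A" for i v
  proof (cases "i = a")
    case True
    then show ?thesis using d2(3)[of v] d1(2) a by simp
  next
    case False
    then have i: "i \<in> A" using that by simp
    then have "i \<noteq> f a" "f i \<noteq> a" "f i \<noteq> f a" using a by (blast, blast, metis imageI)
    then show ?thesis using d1(3)[OF i, of v] d2(2) False by simp
  qed
  moreover have "d2 l = d l" if "l \<notin> insert a A" "l \<notin> f ` insert a A" for l
    using that d1(2) d2(2) by simp
  ultimately show ?case using d2(1) by blast
qed

text \<open>Both halves are averaged recursively, then matched by a bijection and averaged in pairs.
  Each of the \<open>t\<close> levels adds an error \<open>c\<close>.\<close>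

lemma balance_power_of_two:
  assumes "finite S" "card S = 2 ^ t" "S \<subseteq> I" "Q d"
  shows "\<exists>d'. Q d' \<and> (\<forall>l. l \<notin> S \<longrightarrow> d' l = d l) \<and> (\<forall>v. (\<Sum>i\<in>S. d' i v) = (\<Sum>i\<in>S. d i v)) \<and>
    (\<forall>i\<in>S. \<forall>v. \<bar>d' i v - (\<Sum>i\<in>S. d i v) / 2 ^ t\<bar> \<le> c * t)"
  using assms
proof (induction t arbitrary: S d)
  case 0
  then obtain x where "S = {x}" by (auto simp: card_1_singleton_iff)
  then show ?case using 0 by (intro exI[of _ d]) auto
next
  case (Suc t)
  obtain A where A: "A \<subseteq> S" "card A = 2 ^ t" "finite A"
    using obtain_subset_with_card_n[of "2 ^ t" S] Suc.prems by auto
  define B where "B = S - A"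
  have B: "B \<subseteq> S" "card B = 2 ^ t" "finite B" "A \<inter> B = {}" "A \<union> B = S"
    using A Suc.prems by (auto simp: B_def card_Diff_subset)
  obtain d1 where d1: "Q d1" "\<And>l. l \<notin> A \<Longrightarrow> d1 l = d l"
    "\<And>v. (\<Sum>i\<in>A. d1 i v) = (\<Sum>i\<in>A. d i v)"
    "\<And>i v. i \<in> A \<Longrightarrow> \<bar>d1 i v - (\<Sum>i\<in>A. d i v) / 2 ^ t\<bar> \<le> c * t"
    using Suc.IH[OF A(3,2) order_trans[OF A(1) Suc.prems(3)] Suc.prems(4)] by blast
  obtain d2 where d2: "Q d2" "\<And>l. l \<notin> B \<Longrightarrow> d2 l = d1 l"
    "\<And>v. (\<Sum>i\<in>B. d2 i v) = (\<Sum>i\<in>B. d1 i v)"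
    "\<And>i v. i \<in> B \<Longrightarrow> \<bar>d2 i v - (\<Sum>i\<in>B. d1 i v) / 2 ^ t\<bar> \<le> c * t"
    using Suc.IH[OF B(3,2) order_trans[OF B(1) Suc.prems(3)] d1(1)] by blast
  obtain f where f: "bij_betw f A B"
    using finite_same_card_bij[OF A(3) B(3)] A(2) B(2) by auto
  have fA: "f ` A = B" "inj_on f A" using f by (auto simp: bij_betw_def)
  have AI: "A \<subseteq> I" and BI: "B \<subseteq> I" using A(1) B(1) Suc.prems(3) by auto
  obtain d3 where d3: "Q d3" "\<And>l. l \<notin> A \<Longrightarrow> l \<notin> B \<Longrightarrow> d3 l = d2 l"
    "\<And>i v. i \<in> A \<Longrightarrow> d3 i v + d3 (f i) v = d2 i v + d2 (f i) v"
    "\<And>i v. i \<in> A \<Longrightarrow> \<bar>d3 i v - d3 (f i) v\<bar> \<le> 2 * c"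
    using pairs[OF A(3) fA(2) AI, unfolded fA(1), OF BI B(4) d2(1)] by blast
  define a where "a v = (\<Sum>i\<in>A. d i v)" for v
  define b where "b v = (\<Sum>i\<in>B. d i v)" for v
  have ab: "(\<Sum>i\<in>S. d i v) = a v + b v" for v
    using sum.union_disjoint[OF A(3) B(3,4)] unfolding B(5) a_def b_def by simp
  have b1: "(\<Sum>i\<in>B. d1 i v) = b v" for v
    unfolding b_def by (rule sum.cong[OF refl]) (metis B(4) d1(2) disjoint_iff)
  have a2: "(\<Sum>i\<in>A. d2 i v) = a v" for v
  proof -
    have "(\<Sum>i\<in>A. d2 i v) = (\<Sum>i\<in>A. d1 i v)" by (rule sum.cong[OF refl]) (metis B(4) d2(2) disjoint_iff)
    then show ?thesis using d1(3) by (simp add: a_def)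
  qed
  have split: "(\<Sum>i\<in>S. h i) = (\<Sum>i\<in>A. h i + h (f i))" for h :: "nat \<Rightarrow> real"
    using sum.union_disjoint[OF A(3) B(3,4), of h] sum.reindex_bij_betw[OF f, of h]
    unfolding B(5) by (simp add: sum.distrib)
  have "(\<Sum>i\<in>S. d3 i v) = (\<Sum>i\<in>S. d i v)" for v
  proof -
    have "(\<Sum>i\<in>S. d3 i v) = (\<Sum>i\<in>S. d2 i v)" unfolding split using d3(3) by simp
    also have "\<dots> = a v + b v"
      using sum.union_disjoint[OF A(3) B(3,4), of "\<lambda>i. d2 i v"] a2 d2(3) b1 unfolding B(5) by simp
    finally show ?thesis using ab by simp
  qed
  moreover have "\<bar>d3 i v - (\<Sum>i\<in>S. d i v) / 2 ^ Suc t\<bar> \<le> c * Suc t" if "i \<in> S" for i v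
  proof -
    have "\<bar>d3 j v - (a v + b v) / 2 ^ Suc t\<bar> \<le> c * Suc t \<and>
        \<bar>d3 (f j) v - (a v + b v) / 2 ^ Suc t\<bar> \<le> c * Suc t" if j: "j \<in> A" for j
    proof -
      have fj: "f j \<in> B" using j fA(1) by blast
      have "d2 j = d1 j" using d2(2) j B(4) by blast
      then have j1: "\<bar>d2 j v - a v / 2 ^ t\<bar> \<le> c * t" using d1(4)[OF j, of v] by (simp add: a_def)
      have j2: "\<bar>d2 (f j) v - b v / 2 ^ t\<bar> \<le> c * t" using d2(4)[OF fj, of v] b1 by simp
      have eq1: "(a v + b v) / 2 ^ Suc t = (a v / 2 ^ t + b v / 2 ^ t) / 2"
        by (simp add: field_simps)
      have eq2: "c * Suc t = c * t + c" by (simp add: algebra_simps)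
      show ?thesis
        using average_error[OF j1 j2 d3(3)[OF j, of v] d3(4)[OF j, of v]] unfolding eq1 eq2 by blast
    qed
    then show ?thesis using that fA(1) B(5) ab[of v] by (metis Un_iff imageE)
  qed
  moreover have "d3 l = d l" if "l \<notin> S" for l
    using that d1(2) d2(2) d3(2) B(5) by auto
  ultimately show ?case using d3(1) by blast
qed

section \<open>Averaging an arbitrary number of rows\<close>

text \<open>Meant for a block \<open>S\<close> of \<open>2 ^ t\<close> averaged rows and surplus
  rows \<open>R\<close>: the interval of length \<open>w\<close>, whose position may depend on the
  vertex, holds the block average and the surplus rows, while block rows are only close to their
  average.\<close>

definition window :: "nat set \<Rightarrow> nat set \<Rightarrow> nat \<Rightarrow> (nat \<Rightarrow> 'v \<Rightarrow> real) \<Rightarrow> real \<Rightarrow> bool" where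
  "window S R t d w \<longleftrightarrow> (\<forall>v. \<exists>L. (\<forall>i\<in>S. \<bar>d i v - (\<Sum>j\<in>S. d j v) / 2 ^ t\<bar> \<le> c * t) \<and>
     L \<le> (\<Sum>j\<in>S. d j v) / 2 ^ t \<and> (\<Sum>j\<in>S. d j v) / 2 ^ t \<le> L + w \<and> (\<forall>i\<in>R. L \<le> d i v \<and> d i v \<le> L + w))"

text \<open>Each surplus row is averaged with a block row of its own, then the block is averaged
  again. Half of the old width remains; the spread of the block rows adds \<open>c * t\<close> and
  the pairing error adds \<open>2 * c\<close>.\<close>

lemma window_step:
  assumes S: "finite S" "card S = 2 ^ t" "S \<subseteq> I" and R: "finite R" "card R \<le> 2 ^ t" "R \<subseteq> I" "S \<inter> R = {}"
    and d: "Q d" "window S R t d w"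
  shows "\<exists>d'. Q d' \<and> (\<forall>v. (\<Sum>i\<in>S \<union> R. d' i v) = (\<Sum>i\<in>S \<union> R. d i v)) \<and>
    window S R t d' (w / 2 + c * t + 2 * c)"
proof -
  obtain A where A: "A \<subseteq> S" "card A = card R" "finite A"
    using obtain_subset_with_card_n[of "card R" S] S R by auto
  obtain f where f: "bij_betw f A R" using finite_same_card_bij[OF A(3) R(1) A(2)] by auto
  have fA: "f ` A = R" "inj_on f A" using f by (auto simp: bij_betw_def)
  have AR: "A \<inter> R = {}" using A(1) R(4) by auto
  obtain d1 where d1: "Q d1" "\<And>l. l \<notin> A \<Longrightarrow> l \<notin> R \<Longrightarrow> d1 l = d l"
    "\<And>i v. i \<in> A \<Longrightarrow> d1 i v + d1 (f i) v = d i v + d (f i) v"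
    "\<And>i v. i \<in> A \<Longrightarrow> \<bar>d1 i v - d1 (f i) v\<bar> \<le> 2 * c"
    using pairs[OF A(3) fA(2) order_trans[OF A(1) S(3)], unfolded fA(1), OF R(3) AR d(1)] by blast
  obtain d2 where d2: "Q d2" "\<And>l. l \<notin> S \<Longrightarrow> d2 l = d1 l"
    "\<And>v. (\<Sum>i\<in>S. d2 i v) = (\<Sum>i\<in>S. d1 i v)"
    "\<And>i v. i \<in> S \<Longrightarrow> \<bar>d2 i v - (\<Sum>i\<in>S. d1 i v) / 2 ^ t\<bar> \<le> c * t"
    using balance_power_of_two[OF S d1(1)] by blast
  define O' where "O' = S - A"
  have Spl: "S = A \<union> O'" "A \<inter> O' = {}" "finite O'" using A S by (auto simp: O'_def)
  have O1: "d1 i = d i" if "i \<in> O'" for i using that d1(2) R(4) by (auto simp: O'_def)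
  have split: "(\<Sum>i\<in>S \<union> R. h i) = (\<Sum>i\<in>A. h i + h (f i)) + (\<Sum>i\<in>O'. h i)" for h :: "nat \<Rightarrow> real"
  proof -
    have "(\<Sum>i\<in>S \<union> R. h i) = (\<Sum>i\<in>S. h i) + (\<Sum>i\<in>R. h i)"
      using sum.union_disjoint[OF S(1) R(1,4)] .
    moreover have "(\<Sum>i\<in>S. h i) = (\<Sum>i\<in>A. h i) + (\<Sum>i\<in>O'. h i)"
      using sum.union_disjoint[OF A(3) Spl(3,2)] Spl(1) by metis
    moreover have "(\<Sum>i\<in>R. h i) = (\<Sum>i\<in>A. h (f i))" using sum.reindex_bij_betw[OF f] by metis
    ultimately show ?thesis by (simp add: sum.distrib)
  qed
  have "(\<Sum>i\<in>S \<union> R. d2 i v) = (\<Sum>i\<in>S \<union> R. d i v)" for v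
  proof -
    have "(\<Sum>i\<in>R. d2 i v) = (\<Sum>i\<in>R. d1 i v)" by (rule sum.cong[OF refl]) (metis d2(2) R(4) disjoint_iff)
    then have "(\<Sum>i\<in>S \<union> R. d2 i v) = (\<Sum>i\<in>S \<union> R. d1 i v)"
      using sum.union_disjoint[OF S(1) R(1,4)] d2(3) by metis
    also have "\<dots> = (\<Sum>i\<in>S \<union> R. d i v)" unfolding split using d1(3) O1 by simp
    finally show ?thesis .
  qed
  moreover have "window S R t d2 (w / 2 + c * t + 2 * c)"
    unfolding window_def
  proof
    fix v
    define p where "p = (\<Sum>i\<in>S. d i v) / 2 ^ t"
    define p' where "p' = (\<Sum>i\<in>S. d2 i v) / 2 ^ t"
    obtain L where L: "\<And>i. i \<in> S \<Longrightarrow> \<bar>d i v - p\<bar> \<le> c * t" "L \<le> p" "p \<le> L + w"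
      "\<And>i. i \<in> R \<Longrightarrow> L \<le> d i v" "\<And>i. i \<in> R \<Longrightarrow> d i v \<le> L + w"
      using d(2) unfolding window_def p_def by metis
    define a where "a = c * t"
    have a: "0 \<le> a" using c_nonneg by (simp add: a_def)
    \<comment> \<open>The mean of a value in \<open>[L, L + w]\<close> and one within
      \<open>a\<close> of \<open>p\<close> is at least \<open>(p + L) / 2 - a / 2\<close>, and the
      pairing error is \<open>c\<close>.\<close>
    define L' where "L' = (p + L) / 2 - a / 2 - c"
    have w: "0 \<le> w" using L by linarith
    have main: "d1 i v - d i v \<ge> L' - p" "d1 i v - d i v \<le> L' + (w / 2 + a + 2 * c) - p"
      "L' \<le> d1 (f i) v" "d1 (f i) v \<le> L' + (w / 2 + a + 2 * c)" if i: "i \<in> A" for i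
    proof -
      have "f i \<in> R" "i \<in> S" using i fA(1) A(1) by auto
      note L(1)[OF this(2)] L(4)[OF this(1)] L(5)[OF this(1)] d1(3)[OF i, of v] d1(4)[OF i, of v]
      then show "d1 i v - d i v \<ge> L' - p" "d1 i v - d i v \<le> L' + (w / 2 + a + 2 * c) - p"
        "L' \<le> d1 (f i) v" "d1 (f i) v \<le> L' + (w / 2 + a + 2 * c)"
        unfolding L'_def a_def[symmetric] by argo+
    qed
    have p': "2 ^ t * (p' - p) = (\<Sum>i\<in>A. d1 i v - d i v)"
    proof -
      have "2 ^ t * (p' - p) = (\<Sum>i\<in>S. d1 i v - d i v)"
        by (simp add: p'_def p_def d2(3) sum_subtractf algebra_simps)
      also have "\<dots> = (\<Sum>i\<in>A. d1 i v - d i v) + (\<Sum>i\<in>O'. d1 i v - d i v)"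
        using sum.union_disjoint[OF A(3) Spl(3,2)] Spl(1) by metis
      finally show ?thesis using O1 by simp
    qed
    have cA: "real (card A) \<le> 2 ^ t" using A R(2) by (metis of_nat_le_iff of_nat_numeral of_nat_power)
    \<comment> \<open>Zero lies between the bounds on a single summand, so \<open>card A\<close> may
      be replaced by \<open>2 ^ t\<close> in the bounds on the sum.\<close>
    have neg: "L' - p \<le> 0" and posU: "0 \<le> L' + (w / 2 + a + 2 * c) - p"
      using L(2,3) a c_nonneg unfolding L'_def by argo+
    have "2 ^ t * (L' - p) \<le> real (card A) * (L' - p)"
      using mult_right_mono_neg[OF cA neg] .
    also have "\<dots> \<le> 2 ^ t * (p' - p)" unfolding p' using main(1) by (intro sum_bounded_below) auto
    finally have lo: "L' \<le> p'" by simp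
    have "2 ^ t * (p' - p) \<le> real (card A) * (L' + (w / 2 + a + 2 * c) - p)"
      unfolding p' using main(2) by (intro sum_bounded_above) auto
    also have "\<dots> \<le> 2 ^ t * (L' + (w / 2 + a + 2 * c) - p)"
      using mult_right_mono[OF cA posU] .
    finally have hi: "p' \<le> L' + (w / 2 + a + 2 * c)" by simp
    have "L' \<le> d2 i v \<and> d2 i v \<le> L' + (w / 2 + a + 2 * c)" if iR: "i \<in> R" for i
    proof -
      obtain j where "j \<in> A" "i = f j" using iR fA(1) by blast
      moreover have "d2 i = d1 i" using iR d2(2) R(4) by blast
      ultimately show ?thesis using main(3,4) by simp
    qed
    moreover have "\<bar>d2 i v - p'\<bar> \<le> c * t" if "i \<in> S" for i
      using d2(4)[OF that, of v] d2(3)[of v] by (simp add: p'_def)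
    ultimately show "\<exists>L. (\<forall>i\<in>S. \<bar>d2 i v - (\<Sum>j\<in>S. d2 j v) / 2 ^ t\<bar> \<le> c * t) \<and>
        L \<le> (\<Sum>j\<in>S. d2 j v) / 2 ^ t \<and> (\<Sum>j\<in>S. d2 j v) / 2 ^ t \<le> L + (w / 2 + c * t + 2 * c) \<and>
        (\<forall>i\<in>R. L \<le> d2 i v \<and> d2 i v \<le> L + (w / 2 + c * t + 2 * c))"
      using lo hi unfolding a_def p'_def by blast
  qed
  ultimately show ?thesis using d2(1) by blast
qed

text \<open>The map from \<open>w\<close> to \<open>w / 2 + c * t + 2 * c\<close> has the fixed
  point \<open>2 * c * t + 4 * c\<close>. Each round halves the distance to it, and the final
  \<open>+ 1\<close> lets finitely many rounds suffice.\<close>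

lemma balance_window:
  assumes S: "finite S" "card S = 2 ^ t" "S \<subseteq> I" and R: "finite R" "card R \<le> 2 ^ t" "R \<subseteq> I" "S \<inter> R = {}"
    and d: "Q d" and bounded: "\<And>i v. \<bar>d i v\<bar> \<le> M"
  shows "\<exists>d'. Q d' \<and> (\<forall>v. (\<Sum>i\<in>S \<union> R. d' i v) = (\<Sum>i\<in>S \<union> R. d i v)) \<and>
    window S R t d' (2 * c * t + 4 * c + 1)"
proof -
  define W where "W = 2 * c * t + 4 * c"
  have M: "0 \<le> M" using bounded[of undefined undefined] by linarith
  have iter: "\<exists>d'. Q d' \<and> (\<forall>v. (\<Sum>i\<in>S \<union> R. d' i v) = (\<Sum>i\<in>S \<union> R. d i v)) \<and>
      window S R t d' (W + 2 * M / 2 ^ n)" for n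
  proof (induction n)
    case 0
    obtain d' where d': "Q d'" "\<And>l. l \<notin> S \<Longrightarrow> d' l = d l" "\<And>v. (\<Sum>i\<in>S. d' i v) = (\<Sum>i\<in>S. d i v)"
      "\<And>i v. i \<in> S \<Longrightarrow> \<bar>d' i v - (\<Sum>i\<in>S. d i v) / 2 ^ t\<bar> \<le> c * t"
      using balance_power_of_two[OF S d] by blast
    have "(\<Sum>i\<in>S \<union> R. d' i v) = (\<Sum>i\<in>S \<union> R. d i v)" for v
    proof -
      have "(\<Sum>i\<in>R. d' i v) = (\<Sum>i\<in>R. d i v)" by (rule sum.cong[OF refl]) (metis d'(2) R(4) disjoint_iff)
      then show ?thesis using sum.union_disjoint[OF S(1) R(1,4)] d'(3) by metis
    qed
    \<comment> \<open>All original values and block averages lie in \<open>[- M, M]\<close>, an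
      interval of width \<open>2 * M\<close>.\<close>
    moreover have "window S R t d' (W + 2 * M / 2 ^ 0)"
      unfolding window_def
    proof
      fix v
      have W0: "0 \<le> W" using c_nonneg by (simp add: W_def)
      have "\<bar>\<Sum>i\<in>S. d i v\<bar> \<le> (\<Sum>i\<in>S. M)"
        using bounded by (intro order_trans[OF sum_abs] sum_mono) auto
      then have "\<bar>(\<Sum>i\<in>S. d i v) / 2 ^ t\<bar> \<le> M" using S(2) by (simp add: field_simps)
      then have "- M \<le> (\<Sum>i\<in>S. d i v) / 2 ^ t" "(\<Sum>i\<in>S. d i v) / 2 ^ t \<le> - M + (W + 2 * M / 2 ^ 0)"
        using W0 unfolding power_0 by linarith+
      moreover have "- M \<le> d' i v \<and> d' i v \<le> - M + (W + 2 * M / 2 ^ 0)" if "i \<in> R" for i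
      proof -
        have "d' i v = d i v" using d'(2) that R(4) by (metis IntI empty_iff)
        then show ?thesis using bounded[of i v] W0 by auto
      qed
      ultimately show "\<exists>L. (\<forall>i\<in>S. \<bar>d' i v - (\<Sum>j\<in>S. d' j v) / 2 ^ t\<bar> \<le> c * t) \<and>
          L \<le> (\<Sum>j\<in>S. d' j v) / 2 ^ t \<and> (\<Sum>j\<in>S. d' j v) / 2 ^ t \<le> L + (W + 2 * M / 2 ^ 0) \<and> (\<forall>i\<in>R. L \<le> d' i v \<and> d' i v \<le> L + (W + 2 * M / 2 ^ 0))"
        using d'(3,4) by (intro exI[of _ "- M"]) simp
    qed
    ultimately show ?case using d'(1) by blast
  next
    case (Suc n)
    then obtain d1 where d1: "Q d1" "\<And>v. (\<Sum>i\<in>S \<union> R. d1 i v) = (\<Sum>i\<in>S \<union> R. d i v)"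
      "window S R t d1 (W + 2 * M / 2 ^ n)" by blast
    have eq: "(W + 2 * M / 2 ^ n) / 2 + c * t + 2 * c = W + 2 * M / 2 ^ Suc n"
      by (simp add: W_def field_simps)
    obtain d2 where "Q d2" "\<And>v. (\<Sum>i\<in>S \<union> R. d2 i v) = (\<Sum>i\<in>S \<union> R. d1 i v)"
      "window S R t d2 (W + 2 * M / 2 ^ Suc n)"
      using window_step[OF S R d1(1,3), unfolded eq] by blast
    then show ?case using d1(2) by (intro exI[of _ d2]) simp
  qed
  obtain n where "2 * M < 2 ^ n" using real_arch_pow[of 2 "2 * M"] by auto
  then have n: "W + 2 * M / 2 ^ n \<le> W + 1" by (simp add: field_simps)
  have mono: "window S R t d' w'" if win: "window S R t d' w" and ww: "w \<le> w'" for d' w w'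
    unfolding window_def
  proof
    fix v
    obtain L where L: "\<forall>i\<in>S. \<bar>d' i v - (\<Sum>j\<in>S. d' j v) / 2 ^ t\<bar> \<le> c * t"
      "L \<le> (\<Sum>j\<in>S. d' j v) / 2 ^ t" "(\<Sum>j\<in>S. d' j v) / 2 ^ t \<le> L + w"
      "\<forall>i\<in>R. L \<le> d' i v \<and> d' i v \<le> L + w"
      using win unfolding window_def by blast
    then show "\<exists>L. (\<forall>i\<in>S. \<bar>d' i v - (\<Sum>j\<in>S. d' j v) / 2 ^ t\<bar> \<le> c * t) \<and>
        L \<le> (\<Sum>j\<in>S. d' j v) / 2 ^ t \<and> (\<Sum>j\<in>S. d' j v) / 2 ^ t \<le> L + w' \<and>
        (\<forall>i\<in>R. L \<le> d' i v \<and> d' i v \<le> L + w')"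
      using ww by (intro exI[of _ L]) force
  qed
  obtain d' where d': "Q d'" "\<And>v. (\<Sum>i\<in>S \<union> R. d' i v) = (\<Sum>i\<in>S \<union> R. d i v)"
    "window S R t d' (W + 2 * M / 2 ^ n)" using iter by blast
  have "window S R t d' (2 * c * t + 4 * c + 1)" using mono[OF d'(3) n] by (simp add: W_def)
  then show ?thesis using d'(1,2) by blast
qed

text \<open>With block rows counted at their average, \<open>k\<close> times the deviation of a
  surplus row is a sum of \<open>k - 1\<close> differences of size at most \<open>w\<close>, the
  row's difference to itself being 0. The overall mean is within \<open>w / 2\<close> of the block
  average because at most half of all rows are surplus.\<close>

lemma window_deviation:
  assumes S: "finite S" "card S = 2 ^ t" and R: "finite R" "card R \<le> 2 ^ t" "S \<inter> R = {}"
    and k: "k = card S + card R" and win: "window S R t d w"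
  shows "i \<in> R \<Longrightarrow> \<bar>d i v - (\<Sum>j\<in>S \<union> R. d j v) / k\<bar> \<le> w * (1 - 1 / k)"
    and "i \<in> S \<Longrightarrow> \<bar>d i v - (\<Sum>j\<in>S \<union> R. d j v) / k\<bar> \<le> c * t + w / 2"
proof -
  define p where "p = (\<Sum>j\<in>S. d j v) / 2 ^ t"
  obtain L where L: "\<And>i. i \<in> S \<Longrightarrow> \<bar>d i v - p\<bar> \<le> c * t" "L \<le> p" "p \<le> L + w"
    "\<And>i. i \<in> R \<Longrightarrow> L \<le> d i v" "\<And>i. i \<in> R \<Longrightarrow> d i v \<le> L + w"
    using win unfolding window_def p_def by metis
  have k0: "0 < real k" "0 < k" using k S(2) by (auto simp: add_pos_nonneg)
  have w0: "0 \<le> w" using L(2,3) by linarith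
  define \<mu> where "\<mu> = (\<Sum>j\<in>S \<union> R. d j v) / k"
  have mu: "k * \<mu> = 2 ^ t * p + (\<Sum>j\<in>R. d j v)"
    using k0 sum.union_disjoint[OF S(1) R(1,3), of "\<lambda>j. d j v"] by (simp add: \<mu>_def p_def)
  have kr: "real k = 2 ^ t + real (card R)" using k S by simp
  { assume i: "i \<in> R"
    have c1: "real (card (R - {i})) = real (card R) - 1"
      using i R(1) card_Suc_Diff1[of R i] by linarith
    have sR: "(\<Sum>j\<in>R. d j v) = d i v + (\<Sum>j\<in>R - {i}. d j v)" using i R(1) by (simp add: sum.remove)
    have split: "(real k - 1) * x = 2 ^ t * x + real (card (R - {i})) * x" for x
      by (simp add: kr c1 algebra_simps)
    have "real (card (R - {i})) * L \<le> (\<Sum>j\<in>R - {i}. d j v)"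
      using L(4) by (intro sum_bounded_below) auto
    moreover have "(\<Sum>j\<in>R - {i}. d j v) \<le> real (card (R - {i})) * (L + w)"
      using L(5) by (intro sum_bounded_above) auto
    moreover have "2 ^ t * L \<le> 2 ^ t * p" "2 ^ t * p \<le> 2 ^ t * (L + w)" using L(2,3) by auto
    ultimately have "(real k - 1) * L + d i v \<le> k * \<mu>" "k * \<mu> \<le> (real k - 1) * (L + w) + d i v"
      using mu sR split[of L] split[of "L + w"] by linarith+
    then have "k * (d i v - \<mu>) \<le> (real k - 1) * (d i v - L)" "(real k - 1) * (d i v - (L + w)) \<le> k * (d i v - \<mu>)"
      by (auto simp: algebra_simps)
    moreover have "(real k - 1) * (d i v - L) \<le> (real k - 1) * w"
      "(real k - 1) * (- w) \<le> (real k - 1) * (d i v - (L + w))"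
      using L(4,5)[OF i] k0 by (intro mult_left_mono; simp)+
    ultimately have "k * (d i v - \<mu>) \<le> (real k - 1) * w" "- ((real k - 1) * w) \<le> k * (d i v - \<mu>)" by auto
    then have "\<bar>d i v - \<mu>\<bar> \<le> (real k - 1) * w / k"
      using k0 by (simp add: abs_le_iff field_simps)
    then show "\<bar>d i v - (\<Sum>j\<in>S \<union> R. d j v) / k\<bar> \<le> w * (1 - 1 / k)"
      using k0 by (simp add: \<mu>_def field_simps) }
  { assume i: "i \<in> S"
    have "k * (\<mu> - p) = (\<Sum>j\<in>R. d j v - p)" using mu by (simp add: kr sum_subtractf algebra_simps)
    moreover have "\<bar>\<Sum>j\<in>R. d j v - p\<bar> \<le> (\<Sum>j\<in>R. w)"
      using L(2-5) by (intro order_trans[OF sum_abs] sum_mono) (smt (verit))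
    ultimately have "\<bar>k * (\<mu> - p)\<bar> \<le> card R * w" by simp
    also have "\<dots> \<le> (real k / 2) * w" using w0 kr R(2) 
      by (intro mult_right_mono) (auto simp: of_nat_le_iff[symmetric] simp del: of_nat_le_iff)
    finally have "real k * \<bar>\<mu> - p\<bar> \<le> real k * (w / 2)" using k0 by (simp add: abs_mult)
    then have "\<bar>\<mu> - p\<bar> \<le> w / 2" using k0 by simp
    then show "\<bar>d i v - (\<Sum>j\<in>S \<union> R. d j v) / k\<bar> \<le> c * t + w / 2"
      using L(1)[OF i] unfolding \<mu>_def by linarith }
qed

end

section \<open>The constant 11\<close>

lemma log2_bounds:
  assumes "1 \<le> k"
  obtains t where "2 ^ t \<le> k" "k < 2 ^ Suc t" "real t \<le> log 2 (real k)"
proof -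
  have "\<exists>t. 2 ^ t \<le> k \<and> k < 2 ^ Suc t"
    using ex_power_ivl1[of 2 k] assms by auto
  then obtain t where t: "2 ^ t \<le> k" "k < 2 ^ Suc t" by blast
  have "real t = log 2 (2 ^ t)" by simp
  also have "\<dots> \<le> log 2 (real k)"
    using t(1) assms by (subst log_le_cancel_iff) (auto simp: of_nat_le_iff[symmetric] simp del: of_nat_le_iff)
  finally show ?thesis using that t by blast
qed

text \<open>The block size \<open>2 ^ t\<close> is the largest power of two up to \<open>k\<close>,
  so fewer than \<open>2 ^ t\<close> rows are surplus and the errors, linear in \<open>t\<close>,
  are compared with \<open>log 2 k\<close>.\<close>

lemma (in pair_balancing) balance:
  assumes c: "c = 3" and I: "finite I" "card I = k" "1 \<le> k" and d: "Q d" and bounded: "\<And>i v. \<bar>d i v\<bar> \<le> M"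
  shows "\<exists>d'. Q d' \<and> (\<forall>i\<in>I. \<forall>v. \<bar>d' i v - (\<Sum>j\<in>I. d j v) / k\<bar> \<le> 11 * log 2 k)"
proof -
  obtain t where t: "2 ^ t \<le> k" "k < 2 ^ Suc t" "real t \<le> log 2 (real k)"
    using log2_bounds[OF I(3)] by blast
  show ?thesis
  proof (cases "k = 2 ^ t")
    case True
    then have cI: "card I = 2 ^ t" "real k = 2 ^ t" using I by auto
    have le: "c * t \<le> 11 * log 2 k" using t(3) unfolding c by linarith
    from balance_power_of_two[OF I(1) cI(1) order_refl d] obtain d' where
      "Q d'" "\<And>i v. i \<in> I \<Longrightarrow> \<bar>d' i v - (\<Sum>j\<in>I. d j v) / 2 ^ t\<bar> \<le> c * t" by auto
    then show ?thesis using le cI(2) by (metis order_trans)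
  next
    case False
    \<comment> \<open>The case \<open>t = 0\<close> would force \<open>k = 1\<close>, a power of
      two.\<close>
    then have t1: "1 \<le> t" using t by (cases t) auto
    obtain S where S: "S \<subseteq> I" "card S = 2 ^ t" "finite S"
      using obtain_subset_with_card_n[of "2 ^ t" I] t(1) I by auto
    define R where "R = I - S"
    have R: "finite R" "R \<subseteq> I" "S \<inter> R = {}" "S \<union> R = I" "k = card S + card R" "card R \<le> 2 ^ t"
      using S I t by (auto simp: R_def card_Diff_subset)
    define w where "w = 2 * c * t + 4 * c + 1"
    obtain d' where d': "Q d'" "\<And>v. (\<Sum>i\<in>I. d' i v) = (\<Sum>i\<in>I. d i v)" "window S R t d' w"
      using balance_window[OF S(3,2,1) R(1,6,2,3) d bounded] unfolding R(4) w_def by blast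
    have w: "w = 6 * t + 13" using c by (simp add: w_def)
    note dev = window_deviation[OF S(3,2) R(1,6,3,5) d'(3), unfolded R(4) d'(2)]
    have bound: "w * (1 - 1 / k) \<le> 11 * log 2 k \<and> c * t + w / 2 \<le> 11 * log 2 k"
    proof -
      \<comment> \<open>The width \<open>6 * t + 13\<close> is at most \<open>11 * t\<close> from
        \<open>t = 3\<close> on; for smaller \<open>t\<close> the factor \<open>1 - 1 / k\<close>
        makes up the difference.\<close>
      consider "t = 1" | "t = 2" | "3 \<le> t" using t1 by linarith
      then show ?thesis
      proof cases
        case 1
        then have k: "k = 3" using t False by auto
        \<comment> \<open>From \<open>8 \<le> 9\<close> follows \<open>log 2 3 \<ge> 3 / 2\<close>,
          which suffices for the errors \<open>19 * 2 / 3\<close> and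
          \<open>3 + 19 / 2\<close>.\<close>
        have "log 2 ((2::real) ^ 3) \<le> log 2 (3 ^ 2)" by (subst log_le_cancel_iff) auto
        then have "3 \<le> 2 * log 2 (3::real)" by (simp only: log_nat_power) simp
        then show ?thesis using 1 k c by (simp add: w)
      next
        case 2
        then have "k \<le> 7" using t by simp
        then have "1 / 7 \<le> 1 / real k" using I(3) by (simp add: field_simps)
        \<comment> \<open>Here \<open>w = 25\<close>, and \<open>25 * 6 / 7\<close> is below
          22.\<close>
        then have "w * (1 - 1 / k) \<le> w * (6 / 7)" using w by (intro mult_left_mono) auto
        then show ?thesis using 2 t(3) c by (simp add: w)
      next
        case 3
        have "w * (1 - 1 / k) \<le> w * 1" using w by (intro mult_left_mono) auto
        moreover have "3 \<le> real t" using 3 by simp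
        then have "w \<le> 11 * log 2 k" "3 * t + w / 2 \<le> 11 * log 2 k" using w t(3) by linarith+
        ultimately show ?thesis unfolding c by linarith
      qed
    qed
    have "\<bar>d' i v - (\<Sum>j\<in>I. d j v) / k\<bar> \<le> 11 * log 2 k" if "i \<in> I" for i v
    proof (cases "i \<in> R")
      case True
      then show ?thesis using dev(1)[OF True, of v] bound by linarith
    next
      case False
      then have "i \<in> S" using that R(4) by blast
      then show ?thesis using dev(2)[of i v] bound by linarith
    qed
    then show ?thesis using d'(1) by blast
  qed
qed

section \<open>Spanning tree factorizations\<close>

text \<open>A factorization whose trees share vertices and end map, so that only the edge sets
  vary.\<close>

definition tree_partition :: "'v set \<Rightarrow> ('e \<Rightarrow> 'v set) \<Rightarrow> 'e set \<Rightarrow> nat set \<Rightarrow> (nat \<Rightarrow> 'e set) \<Rightarrow> bool" where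
  "tree_partition V en E I F \<longleftrightarrow> (\<forall>i\<in>I. sp_tree V en (F i)) \<and>
     (\<forall>i\<in>I. \<forall>j\<in>I. i \<noteq> j \<longrightarrow> F i \<inter> F j = {}) \<and> (\<Union>i\<in>I. F i) = E"

text \<open>The two trees are recoloured within their union, so disjointness from the other trees
  and the total edge set are kept.\<close>

lemma tree_partition_pair:
  assumes F: "tree_partition V en E I F" and ij: "i \<in> I" "j \<in> I" "i \<noteq> j"
  obtains F' where "tree_partition V en E I F'" "\<And>l. l \<noteq> i \<Longrightarrow> l \<noteq> j \<Longrightarrow> F' l = F l"
    "\<And>v. dg en (F' i) v + dg en (F' j) v = dg en (F i) v + dg en (F j) v"
    "\<And>v. \<bar>real (dg en (F' i) v) - real (dg en (F' j) v)\<bar> \<le> 6"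
proof -
  have T: "sp_tree V en (F i)" "sp_tree V en (F j)" "F i \<inter> F j = {}"
    using F ij by (auto simp: tree_partition_def)
  obtain R B where RB: "sp_tree V en R" "sp_tree V en B" "R \<inter> B = {}" "R \<union> B = F i \<union> F j"
    "\<And>u. \<bar>real (dg en R u) - real (dg en B u)\<bar> \<le> 6"
    using double_tree_balance[OF T] by metis
  have fin: "finite R" "finite B" "finite (F i)" "finite (F j)"
    using RB T by (auto simp: sp_tree_def)
  define F' where "F' = F(i := R, j := B)"
  have F': "F' i = R" "F' j = B" "\<And>l. l \<noteq> i \<Longrightarrow> l \<noteq> j \<Longrightarrow> F' l = F l"
    using ij(3) by (auto simp: F'_def)
  have disj: "F' l \<inter> F' m = {}" if lm: "l \<in> I" "m \<in> I" "l \<noteq> m" for l m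
  proof -
    have old: "F a \<inter> F b = {}" if "a \<in> I" "b \<in> I" "a \<noteq> b" for a b
      using F that by (auto simp: tree_partition_def)
    have out: "F a \<inter> (R \<union> B) = {}" if "a \<in> I" "a \<noteq> i" "a \<noteq> j" for a
      using old[OF that(1) ij(1)] old[OF that(1) ij(2)] that RB(4) by auto
    have sub: "F' a \<subseteq> R \<union> B" if "a = i \<or> a = j" for a using that F' by auto
    consider "l \<in> {i, j}" "m \<in> {i, j}" | "l \<in> {i, j}" "m \<notin> {i, j}" | "l \<notin> {i, j}" "m \<in> {i, j}"
      | "l \<notin> {i, j}" "m \<notin> {i, j}" by blast
    then show ?thesis
    proof cases
      case 1
      then show ?thesis using lm(3) F'(1,2) RB(3) by auto
    next
      case 2
      then show ?thesis using out[OF lm(2)] sub[of l] F'(3)[of m] by auto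
    next
      case 3
      then show ?thesis using out[OF lm(1)] sub[of m] F'(3)[of l] by auto
    next
      case 4
      then show ?thesis using old[OF lm] F'(3) by auto
    qed
  qed
  have split: "(\<Union>l\<in>I. H l) = H i \<union> H j \<union> (\<Union>l\<in>I - {i, j}. H l)" for H :: "nat \<Rightarrow> 'b set"
    using ij(1,2) by auto
  have "(\<Union>l\<in>I. F' l) = R \<union> B \<union> (\<Union>l\<in>I - {i, j}. F l)" unfolding split[of F'] using F' by auto
  also have "\<dots> = (\<Union>l\<in>I. F l)" unfolding split[of F] RB(4) ..
  finally have un: "(\<Union>l\<in>I. F' l) = E" using F by (simp add: tree_partition_def)
  have "sp_tree V en (F' l)" if "l \<in> I" for l
    using that F F' RB(1,2) by (cases "l = i \<or> l = j") (auto simp: tree_partition_def)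
  then have "tree_partition V en E I F'" using disj un by (simp add: tree_partition_def)
  moreover have "dg en R v + dg en B v = dg en (F i) v + dg en (F j) v" for v
    using dg_union_disjoint[OF fin(1,2) RB(3), of en v] dg_union_disjoint[OF fin(3,4) T(3), of en v] RB(4)
    by simp
  ultimately show ?thesis using that[of F'] F' RB(5) by simp
qed

lemma tree_partition_sum_dg:
  assumes "tree_partition V en E I F" "finite I"
  shows "(\<Sum>i\<in>I. dg en (F i) v) = dg en E v"
proof -
  have "{e \<in> E. v \<in> en e} = (\<Union>i\<in>I. {e \<in> F i. v \<in> en e})"
    using assms(1) by (auto simp: tree_partition_def)
  moreover have "card (\<Union>i\<in>I. {e \<in> F i. v \<in> en e}) = (\<Sum>i\<in>I. card {e \<in> F i. v \<in> en e})"
  proof (rule card_UN_disjoint[OF assms(2)])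
    show "\<forall>i\<in>I. finite {e \<in> F i. v \<in> en e}"
      using assms(1) by (simp add: tree_partition_def sp_tree_def)
    show "\<forall>i\<in>I. \<forall>j\<in>I. i \<noteq> j \<longrightarrow> {e \<in> F i. v \<in> en e} \<inter> {e \<in> F j. v \<in> en e} = {}"
      using assms(1) unfolding tree_partition_def by blast
  qed
  ultimately show ?thesis unfolding dg_def by simp
qed

lemma factorization_imp_tree_partition:
  assumes "spanning_tree_factorization k T G"
  shows "tree_partition (vertices G) (ends G) (edges G) {1..k} (\<lambda>i. edges (T i))"
proof -
  have "sp_tree (vertices G) (ends G) (edges (T i))" if "i \<in> {1..k}" for i
  proof -
    have st: "subgraph (T i) G" "vertices (T i) = vertices G" "is_tree (T i)"
      using assms that by (auto simp: spanning_tree_factorization_def spanning_tree_def)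
    have eq: "\<And>e. e \<in> edges (T i) \<Longrightarrow> ends (T i) e = ends G e" using st(1) by (simp add: subgraph_def)
    have "sp_tree (vertices G) (ends (T i)) (edges (T i))"
      using is_tree_imp_sp_tree[OF st(3)] st(2) by simp
    then show ?thesis
      using eq cut_connected_cong[of "edges (T i)" "ends (T i)" "ends G"] by (simp add: sp_tree_def)
  qed
  then show ?thesis
    using assms unfolding tree_partition_def spanning_tree_factorization_def by simp
qed

lemma tree_partition_imp_factorization:
  assumes "wf_multigraph G" "tree_partition (vertices G) (ends G) (edges G) {1..k} F"
  shows "spanning_tree_factorization k (\<lambda>i. \<lparr>vertices = vertices G, edges = F i, ends = ends G\<rparr>) G"
proof -
  have "spanning_tree \<lparr>vertices = vertices G, edges = F i, ends = ends G\<rparr> G" if "i \<in> {1..k}" for i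
  proof -
    have "is_tree \<lparr>vertices = vertices G, edges = F i, ends = ends G\<rparr>"
      using assms(2) that by (intro sp_tree_imp_is_tree) (simp add: tree_partition_def)
    moreover have "F i \<subseteq> edges G" using assms(2) that by (auto simp: tree_partition_def)
    ultimately show ?thesis using assms(1) by (simp add: spanning_tree_def subgraph_def is_tree_def)
  qed
  then show ?thesis
    using assms(2) unfolding tree_partition_def spanning_tree_factorization_def by simp
qed

theorem theorem4:
  fixes k :: nat
  assumes "k \<ge> 1"
  shows "feasible TYPE(('v, 'e) multigraph) k (11 * log 2 (real k))"
  unfolding feasible_def
proof (intro allI impI)
  fix G :: "('v, 'e) multigraph"
  assume "multiple_tree k G"
  then obtain T where wf: "wf_multigraph G" and T: "spanning_tree_factorization k T G"
    by (auto simp: multiple_tree_def)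
  define I where "I = {1..k}"
  define P where "P = tree_partition (vertices G) (ends G) (edges G) I"
  define table where "table F = (\<lambda>i v. real (dg (ends G) (F i) v))" for F :: "nat \<Rightarrow> 'e set"
  define Q where "Q d \<longleftrightarrow> (\<exists>F. P F \<and> d = table F)" for d
  \<comment> \<open>Empty sets outside \<open>I\<close> make the table bounded at every index, as
    \<open>balance\<close> demands.\<close>
  define F where "F i = (if i \<in> I then edges (T i) else {})" for i
  have "P (\<lambda>i. edges (T i))"
    using factorization_imp_tree_partition[OF T] by (simp add: P_def I_def)
  then have PF: "P F" by (simp add: P_def tree_partition_def F_def)
  have I: "finite I" "card I = k" by (auto simp: I_def)
  \<comment> \<open>The error 3 is half of the difference 6 left by balancing two trees.\<close>
  interpret pair_balancing Q I 3
  proof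
    fix d i j assume "Q d" and ij: "i \<in> I" "j \<in> I" "i \<noteq> j"
    then obtain H where H: "P H" "d = table H" by (auto simp: Q_def)
    obtain H' where H': "P H'" "\<And>l. l \<noteq> i \<Longrightarrow> l \<noteq> j \<Longrightarrow> H' l = H l"
      "\<And>v. dg (ends G) (H' i) v + dg (ends G) (H' j) v = dg (ends G) (H i) v + dg (ends G) (H j) v"
      "\<And>v. \<bar>real (dg (ends G) (H' i) v) - real (dg (ends G) (H' j) v)\<bar> \<le> 6"
      using tree_partition_pair[OF H(1)[unfolded P_def] ij] unfolding P_def by metis
    have "table H' i v + table H' j v = table H i v + table H j v" for v
      using H'(3)[of v] unfolding table_def by (metis of_nat_add)
    then show "\<exists>d'. Q d' \<and> (\<forall>l. l \<noteq> i \<longrightarrow> l \<noteq> j \<longrightarrow> d' l = d l) \<and>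
        (\<forall>v. d' i v + d' j v = d i v + d j v \<and> \<bar>d' i v - d' j v\<bar> \<le> 2 * 3)"
      using H'(1,2,4) H(2) by (intro exI[of _ "table H'"]) (auto simp: Q_def table_def)
  qed simp
  have fin: "finite (edges G)" using wf by (simp add: wf_multigraph_def)
  have "F i \<subseteq> edges G" for i using PF by (auto simp: P_def tree_partition_def F_def)
  then have "{e \<in> F i. v \<in> ends G e} \<subseteq> edges G" for i v by blast
  then have bounded: "\<bar>table F i v\<bar> \<le> real (card (edges G))" for i v
    using card_mono[OF fin] unfolding table_def dg_def by simp
  have "Q (table F)" using PF Q_def by blast
  then obtain d where d: "Q d"
    "\<And>i v. i \<in> I \<Longrightarrow> \<bar>d i v - (\<Sum>j\<in>I. table F j v) / k\<bar> \<le> 11 * log 2 k"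
    using balance[of k "table F" "real (card (edges G))"] I assms bounded by blast
  obtain H where H: "P H" "d = table H" using d(1) Q_def by blast
  \<comment> \<open>Every edge lies in exactly one tree, so the target average is the degree in
    \<open>G\<close> divided by \<open>k\<close>.\<close>
  have sum: "(\<Sum>j\<in>I. table F j v) = real (deg G v)" for v
    using tree_partition_sum_dg[OF PF[unfolded P_def] I(1), of v]
    by (simp add: table_def deg_def dg_def flip: of_nat_sum)
  let ?T = "\<lambda>i. \<lparr>vertices = vertices G, edges = H i, ends = ends G\<rparr>"
  have "spanning_tree_factorization k ?T G"
    using tree_partition_imp_factorization[OF wf] H(1) by (simp add: P_def I_def)
  moreover have "\<bar>real (deg (?T i) v) - real (deg G v) / real k\<bar> \<le> 11 * log 2 (real k)"
    if "i \<in> {1..k}" for i v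
    using d(2)[of i v] that H(2) sum[of v] by (simp add: I_def table_def deg_def dg_def)
  ultimately show "\<exists>T. spanning_tree_factorization k T G \<and>
      (\<forall>v\<in>vertices G. \<forall>i\<in>{1..k}. \<bar>real (deg (T i) v) - real (deg G v) / real k\<bar> \<le> 11 * log 2 (real k))"
    by blast
qed

end
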